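(* Let $k\in\mathbb{N}\cup\{0\}$ and let $x\in\mathbb{C}$ with $\mathrm{Re}(x)>0$. Then \[ \mathfrak{F}_{k,1}(x)=(-1)^k x^{k-1}\left\{\mathfrak{F}_{k,1}\left(\frac{1}{x}\right)-\mathcal{B}_k(x)\right\}, \] where: for $k=0$, \[ \mathcal{B}_0(x)=\frac{x}{2}\left(\log\left(\frac{2\pi}{x}\right)-\gamma\right)+\frac{1}{2}\left(\gamma-\log(2\pi x)\right); \] for $k=1$, \[ \mathcal{B}_1(x)=\frac{1}{6}\left(3\log^2(x)+\pi^2-6\gamma^2-12\gamma_1\right)-\frac{\pi^2}{12}\left(x+\frac{1}{x}\right); \] and for $k\geq 2$, \[ \mathcal{B}_k(x)=\zeta(k)(\log x-\gamma)+\zeta'(k)+(-1)^k x^{1-k}\big((\log x+\gamma)\zeta(k)-\zeta'(k)\big)+\frac{(-1)^k}{2x^k}\zeta(k+1)-\frac{x}{2}\zeta(k+1)+\sum_{j=1}^{k-2}(-1)^{j-1}\zeta(j+1)\zeta(k-j)x^{-j}. \]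
   Context: For real numbers $k\ge 0$, $N>0$ with $k+2N>1$ and $x\in\mathbb{C}\setminus(-\infty,0]$, define \[ \mathfrak{F}_{k,N}(x):=\sum_{n=1}^\infty\frac{1}{n^k}\left(\psi(n^Nx)-\log(n^Nx)+\frac{1}{2n^Nx}\right), \] where $\psi=\Gamma'/\Gamma$ is the digamma function and $\log$ is the principal branch. $\zeta$ is the Riemann zeta function, $\gamma$ is Euler's constant, and $\gamma_1$ is the first Stieltjes constant, i.e. $\zeta(s)=\frac{1}{s-1}+\gamma-\gamma_1(s-1)+O((s-1)^2)$ near $s=1$. Powers $x^{a}$ use the principal branch. *)

theory Defs
  imports "HOL-Complex_Analysis.Complex_Analysis" "HOL-Library.Landau_Symbols"
begin

text \<open>
  For \<open>Re z > 1\<close> the function is given by its Dirichlet series; elsewhere by analytic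
  continuation. \<open>zeta_continuation c f\<close> says that \<open>f\<close> continues the series to the half-plane
  \<open>Re z > c\<close> with the pole at \<open>1\<close> removed; these domains are connected, so the value at
  \<open>s \<noteq> 1\<close> does not depend on the choice of \<open>c < Re s\<close> and \<open>f\<close> (lemma \<open>zeta_eqI\<close> below).
  The value at \<open>s = 1\<close> is unspecified.
\<close>

definition zeta_continuation :: "real \<Rightarrow> (complex \<Rightarrow> complex) \<Rightarrow> bool" where
  "zeta_continuation c f \<longleftrightarrow>
     f holomorphic_on {z. Re z > c} - {1} \<and>
     (\<forall>z. Re z > 1 \<longrightarrow> f z = (\<Sum>n. 1 / of_nat (Suc n) powr z))"

definition zeta :: "complex \<Rightarrow> complex" where
  "zeta s = (THE w. \<exists>c f. c < Re s \<and> zeta_continuation c f \<and> f s = w)"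

lemma zeta_continuation_unique:
  assumes f: "zeta_continuation c f" and g: "zeta_continuation d g"
    and "c < Re s" "d < Re s" "s \<noteq> 1"
  shows "f s = g s"
proof (cases "Re s > 1")
  case True
  then show ?thesis using f g by (simp add: zeta_continuation_def)
next
  case False
  define e where "e = max c d"
  have e: "e < Re s" "c \<le> e" "d \<le> e" "e < 1"
    using assms(3,4) False by (auto simp: e_def)
  define A where "A = {z. Re z > e} - {1}"
  define U where "U = {z. Re z > 1}"
  have op: "open {z. Re z > e}" "open U"
    unfolding U_def by (auto simp: open_halfspace_Re_gt)
  have "connected {z. Re z > e}"
    by (intro convex_connected convex_halfspace_Re_gt)
  then have conn: "connected A"
    unfolding A_def using op(1) by (intro connected_open_delete) auto
  have holf: "f holomorphic_on A" and holg: "g holomorphic_on A"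
    using f g e by (auto simp: zeta_continuation_def A_def elim!: holomorphic_on_subset)
  have "(2::complex) \<in> U" by (simp add: U_def)
  have UA: "U \<subseteq> A" using e by (auto simp: U_def A_def)
  show ?thesis
  proof (rule analytic_continuation_open[of U A f g])
    show "open A" unfolding A_def using op(1) by (simp add: open_delete)
    show "U \<noteq> {}" using \<open>2 \<in> U\<close> by blast
    show "f z = g z" if "z \<in> U" for z
      using that f g by (simp add: zeta_continuation_def U_def)
    show "s \<in> A" using e assms(5) by (simp add: A_def)
  qed (use op conn UA holf holg in auto)
qed

lemma zeta_eqI:
  assumes "zeta_continuation c f" "c < Re s" "s \<noteq> 1"
  shows "zeta s = f s"
  unfolding zeta_def
proof (rule the_equality)
  show "\<exists>c' f'. c' < Re s \<and> zeta_continuation c' f' \<and> f' s = f s"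
    using assms by blast
  show "w = f s" if "\<exists>c' f'. c' < Re s \<and> zeta_continuation c' f' \<and> f' s = w" for w
    using that assms zeta_continuation_unique by blast
qed

definition stieltjes_1 :: complex where
  "stieltjes_1 = (THE c.
     (\<lambda>s. zeta s - (1 / (s - 1) + euler_mascheroni - c * (s - 1))) \<in> O[at 1](\<lambda>s. (s - 1)\<^sup>2))"

definition herglotz_F :: "real \<Rightarrow> real \<Rightarrow> complex \<Rightarrow> complex" where
  "herglotz_F k N x =
     (\<Sum>m. let n = real (Suc m); y = of_real (n powr N) * x in
        1 / of_real (n powr k) * (Digamma y - Ln y + 1 / (2 * y)))"

definition herglotz_B :: "nat \<Rightarrow> complex \<Rightarrow> complex" where
  "herglotz_B k x =
     (if k = 0 then
        x / 2 * (Ln (2 * of_real pi / x) - euler_mascheroni)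
          + 1 / 2 * (euler_mascheroni - Ln (2 * of_real pi * x))
      else if k = 1 then
        1 / 6 * (3 * (Ln x)\<^sup>2 + of_real pi ^ 2 - 6 * euler_mascheroni\<^sup>2 - 12 * stieltjes_1)
          - of_real pi ^ 2 / 12 * (x + 1 / x)
      else
        zeta (of_nat k) * (Ln x - euler_mascheroni) + deriv zeta (of_nat k)
          + (-1) ^ k * x powi (1 - int k)
              * ((Ln x + euler_mascheroni) * zeta (of_nat k) - deriv zeta (of_nat k))
          + (-1) ^ k / (2 * x ^ k) * zeta (of_nat (k + 1))
          - x / 2 * zeta (of_nat (k + 1))
          + (\<Sum>j = 1..k - 2. (-1) ^ (j - 1) * zeta (of_nat (j + 1)) * zeta (of_nat (k - j))
               * x powi (- int j)))"

end

theory Submission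
  imports Defs
begin

text \<open>
  Iterating \<open>1 / (n (m + n x)) = 1 / (m n) - x / (m (m + n x))\<close> gives, for the truncated sums
  \<open>S\<^sub>k(x) = (\<Sum>n \<le> M. \<Sum>m \<le> M. 1 / (n\<^sup>k (m + n x)))\<close>, the exact reciprocity
  \<open>S\<^sub>k(x) = (- x)\<^sup>k / x S\<^sub>k(1 / x) + (\<Sum>j < k. (- x)\<^sup>j H\<^sub>j\<^sub>+\<^sub>1 H\<^sub>k\<^sub>-\<^sub>j)\<close>, where \<open>H\<^sub>j\<close> is the
  generalised harmonic number of order \<open>j\<close> at \<open>M\<close>. The inner sum is
  \<open>\<psi>(n x + M + 1) - \<psi>(n x + 1)\<close>. As \<open>\<psi>(z) - log z + 1 / (2 z) = O(1 / z\<^sup>2)\<close> for \<open>Re z > 0\<close>,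
  this equals minus the partial sum of the Herglotz function up to explicit sums of logarithms and
  powers, and letting \<open>M\<close> tend to infinity produces the correction term. Besides \<open>\<gamma>\<close> and zeta
  values, the limit needs Stirling's formula for \<open>k = 0\<close>, and \<open>\<gamma>\<^sub>1\<close> together with the inversion
  formula of the dilogarithm for \<open>k = 1\<close>.
\<close>

section \<open>Quadrature estimates\<close>

text \<open>The inner sums over \<open>1 / (m + n * x)\<close> diverge as \<open>m\<close> runs to
  infinity, for every \<open>k\<close>, so infinite sums cannot simply be interchanged. The square
  cutoff turns the reciprocity into an identity of finite sums, because exchanging the two indices
  maps the square to itself. The price is that \<open>n\<close> reaches the size of
  \<open>M\<close>, so \<open>n * x / M\<close> is not small in \<open>Ln (1 + n * x / M)\<close>.
  For \<open>k >= 2\<close> the weight \<open>1 / n ^ k\<close> suppresses these logarithms. For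
  \<open>k = 1\<close> and \<open>k = 0\<close> they form Riemann sums, which is where the
  dilogarithm and an integral of the logarithm come from. Decay of second order in the digamma
  remainder serves the unweighted case \<open>k = 0\<close> in two ways: the series converges
  absolutely, and the \<open>M\<close> remainders at the points \<open>n * x + M\<close>, each of
  size \<open>1 / M ^ 2\<close>, disappear in the limit. Zeta is given only as an abstract analytic
  continuation, so its derivative and its Laurent coefficient need a concrete approximating sequence
  of finite sums.\<close>

lemma trapezoid_error:
  fixes U u v w :: "complex \<Rightarrow> complex"
  assumes U: "\<And>s. s \<in> closed_segment z (z + h) \<Longrightarrow> (U has_field_derivative u s) (at s)"
    and u: "\<And>s. s \<in> closed_segment z (z + h) \<Longrightarrow> (u has_field_derivative v s) (at s)"
    and v: "\<And>s. s \<in> closed_segment z (z + h) \<Longrightarrow> (v has_field_derivative w s) (at s)"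
    and w: "\<And>s. s \<in> closed_segment z (z + h) \<Longrightarrow> norm (w s) \<le> B"
  shows "norm (U (z + h) - U z - h / 2 * (u z + u (z + h))) \<le> B * norm h ^ 3 / 2"
proof -
  define S where "S = closed_segment z (z + h)"
  have S: "convex S" "z \<in> S" "z + h \<in> S" by (auto simp: S_def)
  have dist: "norm (s - z) \<le> norm h" if "s \<in> S" for s
    using segment_bound(1)[of s z "z + h"] that by (simp add: S_def norm_minus_commute)
  \<comment> \<open>The trapezoid error with a movable endpoint \<open>s\<close>. Both
    \<open>f\<close> and its derivative \<open>f'\<close> vanish at \<open>z\<close>, and the second
    derivative is \<open>- (s - z) * w s / 2\<close>. Two applications of the mean value inequality
    thus give a cubic bound, with \<open>1 / 2\<close> in place of the classical
    \<open>1 / 12\<close>.\<close>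
  define f where "f s = U s - U z - (s - z) / 2 * (u z + u s)" for s
  define f' where "f' s = (u s - u z - (s - z) * v s) / 2" for s
  have f: "(f has_field_derivative f' s) (at s within S)" if "s \<in> S" for s
    unfolding f_def using that unfolding S_def
    by (auto intro!: derivative_eq_intros DERIV_subset[OF U] DERIV_subset[OF u]
        simp: f'_def field_simps)
  have f': "(f' has_field_derivative (- (s - z) * w s / 2)) (at s within S)" if "s \<in> S" for s
    unfolding f'_def using that unfolding S_def
    by (auto intro!: derivative_eq_intros DERIV_subset[OF u] DERIV_subset[OF v]
        simp: field_simps)
  have "norm (w z) \<le> B" using w S by (auto simp: S_def)
  then have B: "B \<ge> 0" using norm_ge_zero order_trans by blast
  have f'_bound: "norm (f' s) \<le> B * norm h ^ 2 / 2" if "s \<in> S" for s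
  proof -
    have "norm (f' s - f' z) \<le> (norm h * B / 2) * norm (s - z)"
    proof (rule field_differentiable_bound[OF S(1) f'])
      fix t assume t: "t \<in> S"
      show "norm (- (t - z) * w t / 2) \<le> norm h * B / 2"
        using dist[OF t] w[of t] t
        by (auto simp: norm_mult norm_divide S_def norm_minus_commute intro!: mult_mono)
    qed (use that S in auto)
    also have "\<dots> \<le> (norm h * B / 2) * norm h"
      using dist[OF that] B by (intro mult_left_mono) auto
    finally show ?thesis by (simp add: f'_def power2_eq_square mult_ac)
  qed
  have "norm (f (z + h) - f z) \<le> (B * norm h ^ 2 / 2) * norm (z + h - z)"
    by (rule field_differentiable_bound[OF S(1) f]) (use S f'_bound in auto)
  then show ?thesis by (simp add: f_def power3_eq_cube power2_eq_square mult_ac)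
qed

text \<open>Right endpoint rule: on each of the \<open>M\<close> pieces the error is at most a bound
  for the derivative of \<open>g\<close> times the squared length of the piece, in total
  \<open>O(1 / M)\<close>. Compactness of the segment supplies that bound, and stating the limit
  through a primitive avoids contour integrals.\<close>

lemma riemann_sum_segment:
  fixes G g :: "complex \<Rightarrow> complex"
  assumes "open S" and S: "closed_segment 0 x \<subseteq> S"
    and G: "\<And>s. s \<in> S \<Longrightarrow> (G has_field_derivative g s) (at s)"
  shows "(\<lambda>M. \<Sum>n=1..M. g (of_nat n * x / of_nat M) * (x / of_nat M)) \<longlonglongrightarrow> G x - G 0"
proof -
  define T where "T = closed_segment 0 x"
  have T: "convex T" "compact T" "T \<subseteq> S" using S by (auto simp: T_def)
  have holG: "G holomorphic_on S"
    using G \<open>open S\<close> by (auto simp: holomorphic_on_open)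
  have "deriv G holomorphic_on S" using holG \<open>open S\<close> by (rule holomorphic_deriv)
  moreover have "deriv G s = g s" if "s \<in> S" for s using G[OF that] by (rule DERIV_imp_deriv)
  ultimately have holg: "g holomorphic_on S" by (simp cong: holomorphic_cong)
  then have "continuous_on S (deriv g)"
    using \<open>open S\<close> by (intro holomorphic_on_imp_continuous_on holomorphic_deriv)
  then have "bounded (deriv g ` T)"
    using T by (intro compact_imp_bounded compact_continuous_image)
        (auto elim: continuous_on_subset)
  then obtain B where B: "\<And>s. s \<in> T \<Longrightarrow> norm (deriv g s) \<le> B"
    by (auto simp: bounded_iff)
  have "0 \<in> T" by (simp add: T_def)
  from B[OF this] have B0: "B \<ge> 0" using norm_ge_zero order_trans by blast
  have g': "(g has_field_derivative deriv g s) (at s)" if "s \<in> S" for s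
    using holg \<open>open S\<close> that by (rule holomorphic_derivI)
  have step: "norm (G b - G a - g b * (b - a)) \<le> B * norm (b - a) * norm (b - a)"
    if ab: "a \<in> T" "b \<in> T" for a b
  proof -
    define R where "R = closed_segment a b"
    have R: "R \<subseteq> T" "convex R" "a \<in> R" "b \<in> R"
      using ab T by (auto simp: R_def closed_segment_subset)
    \<comment> \<open>Subtracting the linear function \<open>g b * s\<close> leaves the derivative
      \<open>g s - g b\<close>, which is itself small by the mean value inequality for
      \<open>g\<close>.\<close>
    have "norm ((G b - g b * b) - (G a - g b * a)) \<le> (B * norm (b - a)) * norm (b - a)"
    proof (rule field_differentiable_bound[of R "\<lambda>s. G s - g b * s" "\<lambda>s. g s - g b"])
      fix s assume s: "s \<in> R"
      show "((\<lambda>s. G s - g b * s) has_field_derivative g s - g b) (at s within R)"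
        using s R T G[of s] by (auto intro!: derivative_eq_intros DERIV_subset[OF G])
      have "norm (g s - g b) \<le> B * norm (s - b)"
        by (rule field_differentiable_bound[OF R(2), of g "deriv g"])
          (use s R T B in \<open>auto intro!: DERIV_subset[OF g']\<close>)
      also have "\<dots> \<le> B * norm (b - a)"
        using segment_bound(2)[of s a b] s B0
        by (intro mult_left_mono) (auto simp: R_def norm_minus_commute)
      finally show "norm (g s - g b) \<le> B * norm (b - a)" .
    qed (use R in auto)
    then show ?thesis by (simp add: algebra_simps)
  qed
  have bound: "norm ((\<Sum>n=1..M. g (of_nat n * x / of_nat M) * (x / of_nat M)) - (G x - G 0))
      \<le> B * norm x ^ 2 / real M" if M: "M > 0" for M
  proof -
    define p where "p n = of_nat n * x / of_nat M" for n
    have pT: "p n \<in> T" if "n \<le> M" for n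
      unfolding T_def closed_segment_def using M that
      by (auto simp: p_def scaleR_conv_of_real intro!: exI[of _ "real n / real M"])
    have dp: "p (Suc n) - p n = x / of_nat M" for n
      by (simp add: p_def diff_divide_distrib[symmetric] algebra_simps)
    have "G x - G 0 = (\<Sum>n<M. G (p (Suc n)) - G (p n))"
      using M by (subst sum_lessThan_telescope) (simp add: p_def)
    moreover have "(\<Sum>n=1..M. g (p n) * (x / of_nat M)) = (\<Sum>n<M. g (p (Suc n)) * (x / of_nat M))"
      by (rule sum.reindex_bij_witness[of _ Suc "\<lambda>n. n - 1"]) auto
    ultimately have "(\<Sum>n=1..M. g (p n) * (x / of_nat M)) - (G x - G 0)
       = - (\<Sum>n<M. G (p (Suc n)) - G (p n) - g (p (Suc n)) * (x / of_nat M))"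
      by (simp add: sum_subtractf)
    also have "norm \<dots> \<le> (\<Sum>n<M. B * norm (x / of_nat M) * norm (x / of_nat M))"
      unfolding norm_minus_cancel
    proof (rule sum_norm_le)
      fix n assume "n \<in> {..<M}"
      then show "norm (G (p (Suc n)) - G (p n) - g (p (Suc n)) * (x / of_nat M))
         \<le> B * norm (x / of_nat M) * norm (x / of_nat M)"
        using step[of "p n" "p (Suc n)"] pT by (simp add: dp)
    qed
    also have "\<dots> = B * norm x ^ 2 / real M"
      using M by (simp add: norm_divide power2_eq_square)
    finally show ?thesis by (simp add: p_def)
  qed
  show ?thesis
  proof (rule Lim_transform_bound[where g = "\<lambda>M. B * norm x ^ 2 / real M", THEN LIM_zero_cancel])
    show "\<forall>\<^sub>F M in sequentially.
      norm ((\<Sum>n=1..M. g (of_nat n * x / of_nat M) * (x / of_nat M)) - (G x - G 0))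
        \<le> norm (B * norm x ^ 2 / real M)"
      using eventually_gt_at_top[of 0]
    proof eventually_elim
      case (elim M)
      then show ?case using bound[of M] B0 by simp
    qed
    show "(\<lambda>M. B * norm x ^ 2 / real M) \<longlonglongrightarrow> 0"
      by (rule lim_const_over_n)
  qed
qed

section \<open>The remainder in the asymptotics of the digamma function\<close>

definition digamma_rem :: "complex \<Rightarrow> complex" where
  "digamma_rem z = Digamma z - Ln z + 1 / (2 * z)"

lemma Re_pos_not_nonpos_Reals: "Re z > 0 \<Longrightarrow> z \<notin> \<real>\<^sub>\<le>\<^sub>0"
  by (auto simp: complex_nonpos_Reals_iff)

lemma Re_pos_nonzero: "Re z > 0 \<Longrightarrow> z \<noteq> 0"
  by auto

lemma Re_inverse_pos: "Re x > 0 \<Longrightarrow> Re (1 / x) > 0"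
  by (simp add: Re_divide zero_less_divide_iff sum_power2_gt_zero_iff)

text \<open>The squared modulus of \<open>z + w\<close> exceeds that of \<open>z\<close> by twice
  the real part of \<open>z * cnj w\<close> plus the squared modulus of \<open>w\<close>. It is
  applied to shifts of the right half-plane by a nonnegative real \<open>w\<close>.\<close>

lemma norm_add_nonneg_ge:
  fixes z w :: complex
  assumes "Re (z * cnj w) \<ge> 0"
  shows "norm z \<le> norm (z + w)"
proof -
  have "norm z ^ 2 \<le> norm (z + w) ^ 2"
    using assms unfolding cmod_power2 by (simp add: power2_eq_square algebra_simps)
  then show ?thesis by (rule power2_le_imp_le) simp
qed

lemma Ln_of_nat_mult:
  "n > 0 \<Longrightarrow> z \<noteq> 0 \<Longrightarrow> Ln (of_nat n * z) = of_real (ln (real n)) + Ln z"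
  using Ln_times_of_nat[of n z] by simp

text \<open>By the recurrence for \<open>Digamma\<close>, the difference is minus the trapezoid
  error for the integral of \<open>1 / s\<close> over \<open>[z, z + 1]\<close>; the summand
  \<open>1 / (2 * z)\<close> of the remainder supplies the endpoint weights. The second derivative
  \<open>2 / s ^ 3\<close> is largest at \<open>z\<close>, since moving right increases the
  modulus.\<close>

lemma digamma_rem_diff_bound:
  assumes "Re z > 0"
  shows "norm (digamma_rem (z + 1) - digamma_rem z) \<le> 1 / norm z ^ 3"
proof -
  have z: "z \<noteq> 0" "z + 1 \<noteq> 0" using assms by (auto simp: complex_eq_iff)
  have seg: "Re s > 0 \<and> s \<noteq> 0 \<and> norm s \<ge> norm z" if "s \<in> closed_segment z (z + 1)" for s
  proof -
    from that obtain t where t: "0 \<le> t" "t \<le> 1" "s = z + of_real t"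
      by (auto simp: closed_segment_def scaleR_conv_of_real algebra_simps)
    then have "norm z \<le> norm s" using assms by (auto intro!: norm_add_nonneg_ge)
    with t show ?thesis using assms by (auto simp: complex_eq_iff)
  qed
  have "norm (Ln (z + 1) - Ln z - 1 / 2 * (1 / z + 1 / (z + 1)))
      \<le> (2 / norm z ^ 3) * norm (1::complex) ^ 3 / 2"
  proof (rule trapezoid_error)
    fix s assume s: "s \<in> closed_segment z (z + 1)"
    note s' = seg[OF s]
    show "(Ln has_field_derivative 1 / s) (at s)"
      using s' has_field_derivative_Ln[of s] Re_pos_not_nonpos_Reals[of s]
          by (simp add: field_simps)
    show "((\<lambda>s. 1 / s) has_field_derivative - 1 / s ^ 2) (at s)"
      using s' by (auto intro!: derivative_eq_intros simp: power2_eq_square field_simps)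
    show "((\<lambda>s. - 1 / s ^ 2) has_field_derivative 2 / s ^ 3) (at s)"
      using s' by (auto intro!: derivative_eq_intros simp: power2_eq_square power3_eq_cube
          field_simps)
    show "norm (2 / s ^ 3) \<le> 2 / norm z ^ 3"
      using s' z by (auto simp: norm_divide norm_power intro!: divide_left_mono power_mono
          mult_pos_pos)
  qed
  moreover have "digamma_rem (z + 1) - digamma_rem z
      = - (Ln (z + 1) - Ln z - 1 / 2 * (1 / z + 1 / (z + 1)))"
  proof -
    have "1 / (2 * (z + 1)) = 1 / 2 * (1 / (z + 1))" "1 / (2 * z) = 1 / 2 * (1 / z)"
      by (simp_all only: divide_divide_eq_left times_divide_eq_left times_divide_eq_right
          mult_1_left mult_1_right mult.commute)
    then show ?thesis unfolding digamma_rem_def Digamma_plus1[OF z(1)]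
        by (simp only:) (simp add: algebra_simps)
  qed
  ultimately show ?thesis by (simp add: norm_minus_commute)
qed

text \<open>Convergence along the integer shifts of one point can be read off the limit formula for
  \<open>Digamma\<close>: unrolling the recurrence gives \<open>Digamma (z + m) - ln m\<close>
  tending to 0, while \<open>Ln (z + m) - ln m\<close> equals \<open>Ln (1 + z / m)\<close>.\<close>

lemma digamma_rem_shift_tendsto_0:
  assumes "Re z > 0"
  shows "(\<lambda>m. digamma_rem (z + of_nat m)) \<longlonglongrightarrow> 0"
proof -
  have Digamma_shift: "Digamma (z + of_nat m) = Digamma z + (\<Sum>n<m. inverse (z + of_nat n))" for m
  proof (induction m)
    case (Suc m)
    have "Re (z + of_nat m) > 0" using assms by simp
    then have "z + of_nat m \<noteq> 0" by (rule Re_pos_nonzero)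
    from Digamma_plus1[OF this] Suc show ?case by (simp add: add_ac inverse_eq_divide)
  qed auto
  have "(\<lambda>m. of_real (ln (real m)) - (\<Sum>n<m. inverse (z + of_nat n))) \<longlonglongrightarrow> Digamma z"
    using Digamma_LIMSEQ Re_pos_nonzero[OF assms] by blast
  then have 1: "(\<lambda>m. Digamma (z + of_nat m) - of_real (ln (real m))) \<longlonglongrightarrow> 0"
    unfolding Digamma_shift
    by (drule_tac tendsto_minus[OF tendsto_diff[OF _ tendsto_const[of "Digamma z"]]])
        (simp add: algebra_simps)
  have inv: "(\<lambda>m. z / of_nat m) \<longlonglongrightarrow> 0"
    by (rule lim_const_over_n)
  then have "(\<lambda>m. Ln (1 + z / of_nat m)) \<longlonglongrightarrow> Ln (1 + 0)"
    by (intro tendsto_intros) auto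
  then have 2: "(\<lambda>m. Ln (1 + z / of_nat m)) \<longlonglongrightarrow> 0" by simp
  have "filterlim (\<lambda>m. z + of_nat m) at_infinity sequentially"
    by (rule tendsto_add_filterlim_at_infinity[OF tendsto_const tendsto_of_nat])
  then have 3: "(\<lambda>m. 1 / 2 * inverse (z + of_nat m)) \<longlonglongrightarrow> 0"
    by (intro tendsto_mult_right_zero filterlim_compose[OF tendsto_inverse_0])
  have "(\<lambda>m. (Digamma (z + of_nat m) - of_real (ln (real m))) - Ln (1 + z / of_nat m)
      + 1 / 2 * inverse (z + of_nat m)) \<longlonglongrightarrow> 0 - 0 + 0"
    by (intro tendsto_intros 1 2 3)
  moreover have "\<forall>\<^sub>F m in sequentially. (Digamma (z + of_nat m) - of_real (ln (real m)))
      - Ln (1 + z / of_nat m)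
      + 1 / 2 * inverse (z + of_nat m) = digamma_rem (z + of_nat m)"
    using eventually_gt_at_top[of 0]
  proof eventually_elim
    case (elim m)
    have "Re (1 + z / of_nat m) > 0" using assms by (auto intro!: add_pos_nonneg)
    then have "Ln (of_nat m * (1 + z / of_nat m)) = of_real (ln (real m)) + Ln (1 + z / of_nat m)"
      by (intro Ln_of_nat_mult elim Re_pos_nonzero)
    also have "of_nat m * (1 + z / of_nat m) = z + of_nat m"
      using elim by (simp add: field_simps)
    finally show ?case by (simp add: digamma_rem_def divide_simps)
  qed
  ultimately have "(\<lambda>m. digamma_rem (z + of_nat m)) \<longlonglongrightarrow> 0 - 0 + 0" by (rule Lim_transform_eventually)
  then show ?thesis by simp
qed

text \<open>
  Since the remainder vanishes at infinity, it is the sum of its differences along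
  \<open>z, z + 1, z + 2, \<dots>\<close>, and the bounds on these are dominated by a telescoping series.
\<close>

lemma digamma_rem_bound:
  assumes z: "Re z > 0" "norm z \<ge> 1"
  shows "norm (digamma_rem z) \<le> 16 / norm z ^ 2"
proof -
  define a where "a = norm z"
  have a: "a \<ge> 1" using z by (simp add: a_def)
  \<comment> \<open>Both \<open>norm z\<close> and \<open>m\<close> bound the modulus of
    \<open>z + m\<close> from below, hence so does their mean \<open>b / 2\<close>, and a difference
    costs at most \<open>8 / b ^ 3\<close>. The constant 16 comes from
    \<open>1 / b ^ 2 - 1 / (b + 1) ^ 2 \<ge> 1 / (2 * b ^ 3)\<close>, which follows from
    \<open>b \<ge> 1\<close>.\<close>
  have sum_bound: "norm (digamma_rem z) - norm (digamma_rem (z + of_nat m))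
      \<le> 16 * (1 / a ^ 2 - 1 / (a + real m) ^ 2)" for m
  proof (induction m)
    case (Suc m)
    define b where "b = a + real m"
    have b: "b \<ge> 1" using a by (simp add: b_def)
    define y where "y = z + of_nat m"
    have y: "Re y > 0" using z by (simp add: y_def)
    have "norm z \<le> norm y" unfolding y_def
      by (rule norm_add_nonneg_ge) (use z in auto)
    moreover have "real m \<le> norm y" using z complex_Re_le_cmod[of y] by (simp add: y_def)
    ultimately have yb: "norm y \<ge> b / 2" by (simp add: a_def b_def)
    have "norm (digamma_rem y) - norm (digamma_rem (y + 1)) \<le> 1 / norm y ^ 3"
      using digamma_rem_diff_bound[OF y] norm_triangle_ineq2[of "digamma_rem y"
          "digamma_rem (y + 1)"]
      by (simp add: norm_minus_commute)
    also have "\<dots> \<le> 1 / (b / 2) ^ 3"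
      using yb b Re_pos_nonzero[OF y] by (intro divide_left_mono power_mono mult_pos_pos) auto
    also have "\<dots> = 8 / b ^ 3" by (simp add: power_divide)
    also have "8 / b ^ 3 \<le> 16 * (1 / b ^ 2 - 1 / (b + 1) ^ 2)"
    proof -
      have "16 * (1 / b ^ 2 - 1 / (b + 1) ^ 2) - 8 / b ^ 3
          = 8 * (2 * b * (2 * b + 1) - (b + 1) ^ 2) / (b ^ 3 * (b + 1) ^ 2)"
        using b by (simp add: divide_simps)
            (simp add: algebra_simps power2_eq_square power3_eq_cube)
      moreover have "2 * b * (2 * b + 1) - (b + 1) ^ 2 = 3 * b ^ 2 - 1" 
        by (simp add: algebra_simps power2_eq_square)
      moreover have "b ^ 2 \<ge> 1" using b by simp
      ultimately show ?thesis using b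
          by (smt (verit) divide_nonneg_pos mult_pos_pos zero_less_power)
    qed
    finally show ?case using Suc by (simp add: y_def b_def add_ac)
  qed auto
  have "(\<lambda>m. norm (digamma_rem (z + of_nat m))) \<longlonglongrightarrow> 0"
    using digamma_rem_shift_tendsto_0[OF z(1)] by (rule tendsto_norm_zero)
  then have "(\<lambda>m. norm (digamma_rem z) - norm (digamma_rem (z + of_nat m)))
      \<longlonglongrightarrow> norm (digamma_rem z) - 0"
    by (intro tendsto_intros)
  moreover have "norm (digamma_rem z) - norm (digamma_rem (z + of_nat m)) \<le> 16 / a ^ 2" for m
    proof -
    have "0 \<le> 16 * (1 / (a + real m) ^ 2)" by simp
    with sum_bound[of m] have
        "norm (digamma_rem z) - norm (digamma_rem (z + of_nat m)) \<le> 16 * (1 / a ^ 2)"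
      unfolding right_diff_distrib by linarith
    then show ?thesis by simp
  qed
  ultimately show ?thesis using LIMSEQ_le_const2[of _ "norm (digamma_rem z) - 0" "16 / a ^ 2"]
      by (auto simp: a_def)
qed

section \<open>Sums of logarithms\<close>

lemma Re_pos_closed_segment:
  assumes "Re a > 0" "Re b > 0" "s \<in> closed_segment a b"
  shows "Re s > 0"
proof -
  have "closed_segment a b \<subseteq> {s. Re s > 0}"
    using assms by (intro closed_segment_subset) (auto intro: convex_halfspace_Re_gt)
  with assms show ?thesis by auto
qed

text \<open>The second derivative of \<open>Ln\<close> is \<open>- 1 / s ^ 2\<close>, controlled by
  a lower bound \<open>r\<close> for the modulus. There are two uses: unit steps at a growing real
  point for Stirling's formula, and short steps \<open>x / M\<close> with
  \<open>r = 1\<close>.\<close>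

lemma Ln_trapezoid_error:
  assumes "Re a > 0" "Re (a + h) > 0" "r > 0"
    and r: "\<And>s. s \<in> closed_segment a (a + h) \<Longrightarrow> r \<le> norm s"
  shows "norm (((a + h) * Ln (a + h) - (a + h)) - (a * Ln a - a) - h / 2 * (Ln a + Ln (a + h)))
      \<le> (1 / r ^ 2) * norm h ^ 3 / 2"
proof (rule trapezoid_error[of a h "\<lambda>s. s * Ln s - s" Ln])
  fix s assume s: "s \<in> closed_segment a (a + h)"
  have Re: "Re s > 0" using Re_pos_closed_segment[OF assms(1,2) s] .
  note s0 = Re_pos_not_nonpos_Reals[OF Re] Re_pos_nonzero[OF Re]
  show "((\<lambda>s. s * Ln s - s) has_field_derivative Ln s) (at s)"
    using s0 by (auto intro!: derivative_eq_intros)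
  show "(Ln has_field_derivative inverse s) (at s)"
    using s0 by (auto intro!: derivative_eq_intros)
  show "(inverse has_field_derivative - (inverse s ^ 2)) (at s)"
    using s0 by (auto intro!: derivative_eq_intros simp: power2_eq_square)
  show "norm (- (inverse s ^ 2)) \<le> 1 / r ^ 2"
    unfolding norm_minus_cancel norm_power norm_inverse power_inverse unfolding inverse_eq_divide
    using r[OF s] \<open>r > 0\<close> s0 by (intro divide_left_mono power_mono mult_pos_pos) auto
qed

text \<open>Both \<open>x\<close> and \<open>1 + 1 / x\<close> lie in the right half-plane, so the
  imaginary parts of their logarithms are below \<open>pi / 2\<close> in modulus and the sum stays
  inside the principal strip.\<close>

lemma Ln_1_plus_inverse:
  assumes "Re x > 0"
  shows "Ln (1 + 1 / x) = Ln (1 + x) - Ln x"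
proof -
  have Re: "Re (1 + 1 / x) > 0" using Re_inverse_pos[OF assms] by simp
  have nz: "x \<noteq> 0" "1 + 1 / x \<noteq> 0" using assms Re by (auto simp del: plus_complex.sel)
  have "\<bar>Im (Ln x)\<bar> < pi / 2" "\<bar>Im (Ln (1 + 1 / x))\<bar> < pi / 2"
    using Re_Ln_pos_lt[OF nz(1)] Re_Ln_pos_lt[OF nz(2)] assms Re by auto
  then have "Ln (x * (1 + 1 / x)) = Ln x + Ln (1 + 1 / x)"
    using nz by (intro Ln_times_simple) auto
  moreover have "x * (1 + 1 / x) = 1 + x" using nz by (simp add: field_simps)
  ultimately show ?thesis by simp
qed

text \<open>The derivative \<open>1 / (1 + s)\<close> has modulus at most 1 where
  \<open>Re s \<ge> 0\<close>, and the segment from 0 to \<open>w\<close> stays there.\<close>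

lemma norm_Ln_1_plus_le:
  assumes "Re w \<ge> 0"
  shows "norm (Ln (1 + w)) \<le> norm w"
proof -
  define S where "S = closed_segment 0 w"
  have S: "Re s \<ge> 0" if "s \<in> S" for s
    using that assms by (auto simp: S_def closed_segment_def)
  have "norm (Ln (1 + w) - Ln (1 + 0)) \<le> 1 * norm (w - 0)"
  proof (rule field_differentiable_bound[of S "\<lambda>s. Ln (1 + s)" "\<lambda>s. inverse (1 + s)"])
    fix s assume s: "s \<in> S"
    have Re: "Re (1 + s) > 0" using S[OF s] by simp
    show "((\<lambda>s. Ln (1 + s)) has_field_derivative inverse (1 + s)) (at s within S)"
      using Re_pos_not_nonpos_Reals[OF Re] by (auto intro!: derivative_eq_intros)
    have "1 \<le> norm (1 + s)" using complex_Re_le_cmod[of "1 + s"] S[OF s] by simp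
    then show "norm (inverse (1 + s)) \<le> 1" by (simp add: norm_inverse inverse_le_1_iff)
  qed (auto simp: S_def)
  then show ?thesis by simp
qed

section \<open>Stirling's formula, with the constant taken from Wallis' product\<close>

lemma stirling_constant_exists:
  "\<exists>c. (\<lambda>n. ln (fact n) - ((real n + 1 / 2) * ln (real n) - real n)) \<longlonglongrightarrow> c"
proof -
  define d where "d n = ln (fact n) - ((real n + 1 / 2) * ln (real n) - real n)" for n :: nat
  \<comment> \<open>Up to sign the increment is the trapezoid error for the logarithm on
    \<open>[n + 1, n + 2]\<close>, so the increments are summable.\<close>
  have step: "norm (d (Suc (Suc n)) - d (Suc n)) \<le> 1 / real (Suc n) ^ 2" for n
  proof -
    define a where "a = real (Suc n)"
    have a: "a > 0" by (simp add: a_def)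
    have "norm (((of_real a + 1) * Ln (of_real a + 1) - (of_real a + 1))
        - (of_real a * Ln (of_real a) - of_real a) - 1 / 2 *
        (Ln (of_real a) + Ln (of_real a + 1))) \<le> (1 / a ^ 2) * norm (1::complex) ^ 3 / 2"
    proof (rule Ln_trapezoid_error)
      fix s :: complex assume "s \<in> closed_segment (of_real a) (of_real a + 1)"
      then obtain u where "0 \<le> u" "s = of_real (a + u)"
        by (auto simp: closed_segment_def scaleR_conv_of_real algebra_simps)
      then show "a \<le> norm s" using a by (simp del: of_real_add)
    qed (use a in auto)
    also have "((of_real a + 1) * Ln (of_real a + 1) - (of_real a + 1))
        - (of_real a * Ln (of_real a) - of_real a) - 1 / 2 * (Ln (of_real a) + Ln (of_real a + 1))
      = complex_of_real (((a + 1) * ln (a + 1) - (a + 1)) - (a * ln a - a) - 1 / 2 *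
          (ln a + ln (a + 1)))"
    proof -
      have "Ln (of_real a) = of_real (ln a)" "Ln (of_real a + 1) = of_real (ln (a + 1))"
        using a Ln_of_real[of a] Ln_of_real[of "a + 1"] by simp_all
      then show ?thesis by simp
    qed
    also have "((a + 1) * ln (a + 1) - (a + 1)) - (a * ln a - a) - 1 / 2 * (ln a + ln (a + 1))
        = - (d (Suc (Suc n)) - d (Suc n))"
    proof -
      have "ln (fact (Suc (Suc n)) :: real) = ln (a + 1) + ln (fact (Suc n))"
        using a by (subst fact_Suc, subst ln_mult) (auto simp: a_def add_ac)
      moreover have "real (Suc (Suc n)) = a + 1" "real (Suc n) = a" by (simp_all add: a_def)
      ultimately show ?thesis unfolding d_def by (simp only:) (simp add: field_simps)
    qed
    finally have "norm (d (Suc (Suc n)) - d (Suc n)) \<le> 1 / a ^ 2 / 2"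
      by (simp del: of_real_diff of_real_minus add: abs_minus_commute)
    also have "\<dots> \<le> 1 / a ^ 2" by (simp add: divide_simps)
    finally show ?thesis by (simp add: a_def)
  qed
  have "summable (\<lambda>n. 1 / real (Suc n) ^ 2)"
    using inverse_squares_sums by (auto simp: sums_iff add_ac)
  then have "summable (\<lambda>n. d (Suc (Suc n)) - d (Suc n))"
    by (rule summable_comparison_test'[where N = 0]) (rule step)
  then have "convergent (\<lambda>N. \<Sum>n<N. d (Suc (Suc n)) - d (Suc n))"
    by (simp add: summable_iff_convergent)
  then have "convergent (\<lambda>N. d (Suc N) - d (Suc 0))"
    by (subst (asm) sum_lessThan_telescope)
  then obtain c where "(\<lambda>N. d (Suc N) - d (Suc 0)) \<longlonglongrightarrow> c" by (auto simp: convergent_def)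
  from tendsto_add[OF this tendsto_const[of "d (Suc 0)"]] have "(\<lambda>N. d (Suc N)) \<longlonglongrightarrow> c + d (Suc 0)"
      by simp
  then have "d \<longlonglongrightarrow> c + d (Suc 0)" by (rule LIMSEQ_imp_Suc)
  then show ?thesis unfolding d_def by blast
qed

text \<open>Cancellation in the partial product of Wallis leaves only factorials of \<open>n\<close>
  and \<open>2 * n\<close>, the form in which it can be compared with Stirling's
  approximation.\<close>

lemma wallis_fact:
  "(\<Prod>k=1..n. (4 * real k ^ 2) / (4 * real k ^ 2 - 1))
      = 2 ^ (4 * n) * fact n ^ 4 / (fact (2 * n) ^ 2 * (2 * real n + 1))"
proof (induction n)
  case (Suc n)
  have f: "fact (2 * Suc n) = 2 * (real n + 1) * (2 * real n + 1) * fact (2 * n)"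
      "fact (Suc n) = (real n + 1) * fact n"
    by (simp_all add: algebra_simps)
  have q: "4 * real (Suc n) ^ 2 - 1 = (2 * real n + 1) * (2 * real n + 3)"
    by (simp add: algebra_simps power2_eq_square)
  have alg: "A * F ^ 4 / (G ^ 2 * b) * (4 * a ^ 2 / (b * c))
      = 16 * A * (a * F) ^ 4 / ((2 * a * b * G) ^ 2 * c)"
    if "a > 0" "b > 0" "c > 0" "G > 0" for A F G a b c :: real
    using that by (simp add: field_simps power2_eq_square power4_eq_xxxx)
  have "(\<Prod>k=1..Suc n. (4 * real k ^ 2) / (4 * real k ^ 2 - 1)) =
     2 ^ (4 * n) * fact n ^ 4 / (fact (2 * n) ^ 2 * (2 * real n + 1)) *
         ((4 * real (Suc n) ^ 2) / (4 * real (Suc n) ^ 2 - 1))"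
    using Suc by simp
  also have "\<dots> = 16 * 2 ^ (4 * n) * ((real n + 1) * fact n) ^ 4
      / ((2 * (real n + 1) * (2 * real n + 1) * fact (2 * n)) ^ 2 * (2 * real n + 3))"
    unfolding q using alg[of "real n + 1" "2 * real n + 1" "2 * real n + 3" "fact (2 * n)"
        "2 ^ (4 * n)" "fact n"]
    by (simp only: of_nat_Suc add.commute[of 1]) simp
  also have "\<dots> = 2 ^ (4 * Suc n) * fact (Suc n) ^ 4
      / (fact (2 * Suc n) ^ 2 * (2 * real (Suc n) + 1))"
  proof -
    have "2 ^ (4 * Suc n) = (16 * 2 ^ (4 * n) :: real)" "2 * real (Suc n) + 1 = 2 * real n + 3"
      by (simp_all add: power_add)
    then show ?thesis unfolding f by (simp only:)
  qed
  finally show ?case .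
qed auto

lemma stirling_ln_fact:
  "(\<lambda>n. ln (fact n) - ((real n + 1 / 2) * ln (real n) - real n)) \<longlonglongrightarrow> ln (2 * pi) / 2"
proof -
  define d where "d n = ln (fact n) - ((real n + 1 / 2) * ln (real n) - real n)" for n :: nat
  obtain c where c: "d \<longlonglongrightarrow> c" using stirling_constant_exists unfolding d_def by blast
  have c2: "(\<lambda>n. d (2 * n)) \<longlonglongrightarrow> c"
    by (rule filterlim_compose[OF c]) (rule filterlim_subseq, simp add: strict_mono_def)
  define W where "W n = (\<Prod>k=1..n. (4 * real k ^ 2) / (4 * real k ^ 2 - 1))" for n :: nat
  have W: "(\<lambda>n. ln (W n)) \<longlonglongrightarrow> ln (pi / 2)"
    unfolding W_def by (intro tendsto_ln wallis) auto
  \<comment> \<open>In this combination all growing terms of the Stirling approximations at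
    \<open>n\<close> and \<open>2 * n\<close> cancel, and what is left is the logarithm of the
    Wallis product. Its limit yields \<open>2 * c = 2 * ln 2 + ln (pi / 2)\<close>.\<close>
  have "(\<lambda>n. 4 * d n - 2 * d (2 * n) - ln 2 - ln (2 + 1 / real n))
      \<longlonglongrightarrow> 4 * c - 2 * c - ln 2 - ln (2 + 0)"
    by (intro tendsto_intros c c2 lim_1_over_n) auto
  moreover have "\<forall>\<^sub>F n in sequentially. 4 * d n - 2 * d (2 * n) - ln 2 - ln (2 + 1 / real n)
      = ln (W n)"
    using eventually_gt_at_top[of 0]
  proof eventually_elim
    case (elim n)
    have n: "real n > 0" using elim by simp
    have "ln (W n) = real (4 * n) * ln 2
        + 4 * ln (fact n) - (2 * ln (fact (2 * n)) + ln (2 * real n + 1))"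
      unfolding W_def wallis_fact using n
      by (simp add: ln_div ln_mult ln_realpow)
    moreover have "ln (2 * real n + 1) = ln (real n) + ln (2 + 1 / real n)"
    proof -
      have "2 * real n + 1 = real n * (2 + 1 / real n)" using n by (simp add: field_simps)
      moreover have "2 + 1 / real n > 0" using n by (intro add_pos_pos) auto
      ultimately show ?thesis using n by (simp add: ln_mult_pos)
    qed
    moreover have "ln (real (2 * n)) = ln 2 + ln (real n)" using n by (simp add: ln_mult)
    ultimately show ?case unfolding d_def by (simp add: algebra_simps)
  qed
  ultimately have "(\<lambda>n. ln (W n)) \<longlonglongrightarrow> 4 * c - 2 * c - ln 2 - ln (2 + 0)"
    by (rule Lim_transform_eventually)
  from LIMSEQ_unique[OF this W] have "2 * c = 2 * ln 2 + ln (pi / 2)" by simp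
  moreover have "ln (pi / 2) = ln pi - ln 2" "ln (2 * pi) = ln 2 + ln pi"
    by (rule ln_divide_pos ln_mult_pos; simp)+
  ultimately have "c = ln (2 * pi) / 2" by simp
  with c show ?thesis by (simp only: d_def[abs_def])
qed

section \<open>Logarithms and reciprocals along the points \<open>1 + n * x / M\<close>\<close>

lemma Re_1_plus_frac_pos:
  "Re x > 0 \<Longrightarrow> Re (1 + of_nat n * x / of_nat M) > 0"
  by (auto intro!: add_pos_nonneg)

text \<open>Trapezoid rule with step \<open>h = x / M\<close> for the integral of \<open>Ln\<close>
  from 1 to \<open>1 + x\<close>. The subtracted linear term is this integral divided by
  \<open>h\<close>, and the limit is the half weight of the right endpoint. There are
  \<open>M\<close> errors of order \<open>h ^ 3\<close>, so \<open>O(1 / M)\<close> remains after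
  division by \<open>h\<close>.\<close>

lemma sum_Ln_limit:
  assumes x: "Re x > 0"
  shows "(\<lambda>M. (\<Sum>n=1..M. Ln (1 + of_nat n * x / of_nat M))
      - of_nat M * ((1 + 1 / x) * Ln (1 + x) - 1)) \<longlonglongrightarrow> Ln (1 + x) / 2"
proof (rule LIM_zero_cancel, rule Lim_transform_bound[where g = "\<lambda>M. norm x ^ 2 / 2 / real M"])
  show "(\<lambda>M. norm x ^ 2 / 2 / real M) \<longlonglongrightarrow> 0" by (rule lim_const_over_n)
  have x0: "x \<noteq> 0" using x by auto
  show "\<forall>\<^sub>F M in sequentially. norm ((\<Sum>n=1..M. Ln (1 + of_nat n * x / of_nat M))
      - of_nat M * ((1 + 1 / x) * Ln (1 + x) - 1) - Ln (1 + x) / 2) \<le> norm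
      (norm x ^ 2 / 2 / real M)"
    using eventually_gt_at_top[of 0]
  proof eventually_elim
    case (elim M)
    define p where "p n = 1 + of_nat n * x / of_nat M" for n
    define U where "U s = s * Ln s - s" for s :: complex
    define h where "h = x / of_nat M"
    have Mh: "of_nat M * h = x" "h \<noteq> 0" using elim x0 by (auto simp: h_def)
    have pS: "p (Suc n) = p n + h" for n by (simp add: p_def h_def add_divide_distrib algebra_simps)
    have pRe: "Re (p n) \<ge> 1" for n using x by (simp add: p_def)
    have p0: "p 0 = 1" and pM: "p M = 1 + x" using elim by (auto simp: p_def)
    have step: "norm (U (p (Suc n)) - U (p n) - h / 2 * (Ln (p n) + Ln (p (Suc n))))
        \<le> norm h ^ 3 / 2" for n
    proof -
      have "norm (U (p n + h) - U (p n) - h / 2 * (Ln (p n) + Ln (p n + h)))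
          \<le> (1 / 1 ^ 2) * norm h ^ 3 / 2"
        unfolding U_def
      proof (rule Ln_trapezoid_error)
        fix s assume s: "s \<in> closed_segment (p n) (p n + h)"
        have "closed_segment (p n) (p n + h) \<subseteq> {s. Re s \<ge> 1}"
          using pRe[of n] pRe[of "Suc n"] unfolding pS
          by (intro closed_segment_subset convex_halfspace_Re_ge) auto
        with s have "Re s \<ge> 1" by auto
        then show "1 \<le> norm s" using complex_Re_le_cmod[of s] by linarith
      qed (use pRe[of n] pRe[of "Suc n"] in \<open>auto simp flip: pS\<close>)
      then show ?thesis by (simp add: pS)
    qed
    have "(\<Sum>n<M. Ln (p n)) = (\<Sum>n<M. Ln (p (Suc n))) - Ln (1 + x)"
      using sum_lessThan_telescope[of "\<lambda>n. Ln (p n)" M] p0 pM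
          by (simp add: sum_subtractf algebra_simps)
    moreover have "(\<Sum>n=1..M. Ln (p n)) = (\<Sum>n<M. Ln (p (Suc n)))"
      by (rule sum.reindex_bij_witness[of _ Suc "\<lambda>n. n - 1"]) auto
    ultimately have "(\<Sum>n<M. U (p (Suc n)) - U (p n) - h / 2 * (Ln (p n) + Ln (p (Suc n))))
      = U (1 + x) - U 1 - h * ((\<Sum>n=1..M. Ln (p n)) - Ln (1 + x) / 2)"
      using sum_lessThan_telescope[of "\<lambda>n. U (p n)" M] p0 pM
      by (simp only: sum_subtractf sum.distrib flip: sum_distrib_left) (simp add: field_simps)
    also have "\<dots> = - h * ((\<Sum>n=1..M. Ln (p n)) - of_nat M * ((1 + 1 / x) * Ln (1 + x) - 1)
        - Ln (1 + x) / 2)"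
    proof -
      have "U (1 + x) - U 1 = x * ((1 + 1 / x) * Ln (1 + x) - 1)"
        using x0 by (simp add: U_def field_simps)
      also have "\<dots> = h * (of_nat M * ((1 + 1 / x) * Ln (1 + x) - 1))"
        using Mh(1) by (simp add: mult_ac flip: mult.assoc)
      finally show ?thesis by (simp add: algebra_simps)
    qed
    finally have "norm h * norm ((\<Sum>n=1..M. Ln (p n)) - of_nat M * ((1 + 1 / x) * Ln (1 + x) - 1)
        - Ln (1 + x) / 2)
       = norm (\<Sum>n<M. U (p (Suc n)) - U (p n) - h / 2 * (Ln (p n) + Ln (p (Suc n))))"
      by (simp add: norm_mult)
    also have "\<dots> \<le> (\<Sum>n<M. norm h ^ 3 / 2)"
      by (rule sum_norm_le) (use step in auto)
    also have "\<dots> = norm h * (norm x ^ 2 / 2 / real M)"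
      using elim by (simp add: h_def norm_divide power2_eq_square power3_eq_cube)
    finally have "norm ((\<Sum>n=1..M. Ln (p n)) - of_nat M * ((1 + 1 / x) * Ln (1 + x) - 1)
        - Ln (1 + x) / 2) \<le> norm x ^ 2 / 2 / real M"
      using Mh(2) mult_le_cancel_left_pos[of "norm h"] by (simp only: zero_less_norm_iff simp_thms)
    then show ?case by (simp add: p_def)
  qed
qed

text \<open>Multiplied by \<open>x\<close>, this is a Riemann sum for \<open>1 / (1 + s)\<close> on
  the segment from 0 to \<open>x\<close>. It is the part of \<open>ratio_sum\<close> coming from
  \<open>1 / (2 * z)\<close>, which survives in the limit for \<open>k = 0\<close>.\<close>

lemma sum_inverse_limit:
  assumes x: "Re x > 0"
  shows "(\<lambda>M. \<Sum>n=1..M. 1 / (of_nat n * x + of_nat M)) \<longlonglongrightarrow> Ln (1 + x) / x"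
proof -
  have x0: "x \<noteq> 0" using x by auto
  define S where "S = {s. Re s > - 1}"
  have "(\<lambda>M. \<Sum>n=1..M. inverse (1 + of_nat n * x / of_nat M) * (x / of_nat M))
      \<longlonglongrightarrow> Ln (1 + x) - Ln (1 + 0)"
  proof (rule riemann_sum_segment)
    show "open S" unfolding S_def by (rule open_halfspace_Re_gt)
    show "closed_segment 0 x \<subseteq> S"
      using x by (intro closed_segment_subset) (auto simp: S_def convex_halfspace_Re_gt)
    fix s assume "s \<in> S"
    then have "Re (1 + s) > 0" by (simp add: S_def)
    then show "((\<lambda>s. Ln (1 + s)) has_field_derivative inverse (1 + s)) (at s)"
      using Re_pos_not_nonpos_Reals by (auto intro!: derivative_eq_intros)
  qed
  then have "(\<lambda>M. (\<Sum>n=1..M. inverse (1 + of_nat n * x / of_nat M) * (x / of_nat M)) / x)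
      \<longlonglongrightarrow> (Ln (1 + x) - Ln (1 + 0)) / x"
    using x0 by (intro tendsto_intros) auto
  moreover have "(\<Sum>n=1..M. inverse (1 + of_nat n * x / of_nat M) * (x / of_nat M)) / x
      = (\<Sum>n=1..M. 1 / (of_nat n * x + of_nat M))" for M
    unfolding sum_divide_distrib
  proof (rule sum.cong)
    fix n assume "n \<in> {1..M}"
    then have "M > 0" by auto
    have "Re (of_nat n * x + of_nat M) > 0" using x \<open>M > 0\<close> by (auto intro!: add_nonneg_pos)
    then have "of_nat n * x + of_nat M \<noteq> 0" by (rule Re_pos_nonzero)
    moreover have "1 + of_nat n * x / of_nat M = (of_nat n * x + of_nat M) / of_nat M"
      using \<open>M > 0\<close> by (simp add: field_simps)
    ultimately show "inverse (1 + of_nat n * x / of_nat M) * (x / of_nat M) / x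
        = 1 / (of_nat n * x + of_nat M)"
      using \<open>M > 0\<close> x0 by (simp only: inverse_divide) simp
  qed auto
  ultimately show ?thesis by simp
qed

lemma harm_over_n_tendsto_0: "(\<lambda>n. harm n / real n) \<longlonglongrightarrow> 0"
proof -
  have "(\<lambda>n. (harm n - ln (real n)) * (1 / real n) + ln (real n) / real n)
      \<longlonglongrightarrow> euler_mascheroni * 0 + 0"
    by (intro tendsto_intros euler_mascheroni_LIMSEQ lim_1_over_n lim_ln_over_n)
  then show ?thesis by (simp add: diff_divide_distrib)
qed

section \<open>The dilogarithm\<close>

text \<open>The alternating sum is the full sum minus twice its part over even integers, and that
  doubled part is half of the full sum. Denominators are \<open>Suc n\<close>, so even integers
  correspond to odd \<open>n\<close>.\<close>

lemma alternating_inverse_squares_sums: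
  "(\<lambda>n. (- 1) ^ n / real (Suc n) ^ 2) sums (pi ^ 2 / 12)"
proof -
  have S: "(\<lambda>n. 1 / real (Suc n) ^ 2) sums (pi ^ 2 / 6)"
    using inverse_squares_sums by (simp add: add_ac)
  define b where "b n = (if odd n then 2 / real (Suc n) ^ 2 else 0)" for n :: nat
  have "b (2 * k + 1) = 1 / 2 * (1 / real (Suc k) ^ 2)" for k
  proof -
    have "real (Suc (2 * k + 1)) = 2 * real (Suc k)" by simp
    then show ?thesis unfolding b_def by (simp only: power_mult_distrib) simp
  qed
  then have "(\<lambda>k. b (2 * k + 1)) sums (1 / 2 * (pi ^ 2 / 6))"
    using sums_mult[OF S, of "1 / 2"] by (simp only:)
  then have "b sums (1 / 2 * (pi ^ 2 / 6))"
  proof (subst (asm) sums_mono_reindex[of "\<lambda>k. 2 * k + 1" b])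
    fix n assume "n \<notin> range (\<lambda>k::nat. 2 * k + 1)"
    then have "even n" by (metis oddE rangeI)
    then show "b n = 0" by (simp add: b_def)
  qed (auto simp: strict_mono_def)
  from sums_diff[OF S this] have
      "(\<lambda>n. 1 / real (Suc n) ^ 2 - b n) sums (pi ^ 2 / 6 - 1 / 2 * (pi ^ 2 / 6))" .
  moreover have "1 / real (Suc n) ^ 2 - b n = (- 1) ^ n / real (Suc n) ^ 2" for n
    by (auto simp: b_def simp flip: diff_divide_distrib)
  ultimately show ?thesis by simp
qed

text \<open>The derivative of \<open>- Li2 (- s)\<close>. Since division by zero gives 0, the
  removable singularity at 0 has to be filled by hand to keep the function holomorphic.\<close>

definition Ln1_quot :: "complex \<Rightarrow> complex" where
  "Ln1_quot s = (if s = 0 then 1 else Ln (1 + s) / s)"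

lemma Ln1_quot_holomorphic: "Ln1_quot holomorphic_on {s. Re s > - 1}"
proof -
  define S where "S = {s. Re s > - 1}"
  have nn: "1 + s \<notin> \<real>\<^sub>\<le>\<^sub>0" if "s \<in> S" for s
    using that by (intro Re_pos_not_nonpos_Reals) (simp add: S_def)
  have hol: "(\<lambda>s. Ln (1 + s)) holomorphic_on S"
    using nn by (intro holomorphic_intros) auto
  have "((\<lambda>s. Ln (1 + s)) has_field_derivative 1) (at 0)"
    by (auto intro!: derivative_eq_intros)
  then have "deriv (\<lambda>s. Ln (1 + s)) 0 = 1" by (rule DERIV_imp_deriv)
  then have "Ln1_quot = (\<lambda>z. if z
      = 0 then deriv (\<lambda>s. Ln (1 + s)) 0 else (Ln (1 + z) - Ln (1 + 0)) / (z - 0))"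
    by (auto simp: Ln1_quot_def fun_eq_iff)
  moreover have "\<dots> holomorphic_on S"
    using hol by (rule pole_lemma_open) (simp add: S_def open_halfspace_Re_gt)
  ultimately show ?thesis unfolding S_def by simp
qed

text \<open>
  On the unit disc a primitive is given by the series for \<open>- Li\<^sub>2 (- s)\<close>; the value at \<open>1\<close>
  follows by continuity.
\<close>

lemma Ln1_quot_primitive_at_1:
  assumes L: "\<And>s. Re s > - 1 \<Longrightarrow> (L has_field_derivative Ln1_quot s) (at s)"
  shows "L 1 - L 0 = of_real (pi ^ 2 / 12)"
proof -
  define f where "f n s = (- 1) ^ n * s ^ Suc n / of_nat (Suc n) ^ 2" for n and s :: complex
  define D where "D s = (\<Sum>n. f n s)" for s
  have ul: "uniform_limit (cball 0 1) (\<lambda>N s. \<Sum>n<N. f n s) D sequentially"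
    unfolding D_def
  proof (rule Weierstrass_m_test)
    fix n s assume "s \<in> cball (0::complex) 1"
    then have "norm s ^ Suc n \<le> 1" by (intro power_le_one) auto
    then show "norm (f n s) \<le> 1 / real (Suc n) ^ 2"
      unfolding f_def norm_divide norm_mult norm_power norm_of_nat by (intro divide_mono) auto
  next
    show "summable (\<lambda>n. 1 / real (Suc n) ^ 2)"
      using inverse_squares_sums by (auto simp: sums_iff add_ac)
  qed
  have contD: "continuous_on (cball 0 1) D"
    by (rule uniform_limit_theorem[OF _ ul])
        (auto intro!: always_eventually continuous_intros simp: f_def simp del: of_nat_Suc)
  have ul': "uniform_limit (ball 0 1) (\<lambda>N s. \<Sum>n<N. f n s) D sequentially"
    using ul by (rule uniform_limit_on_subset) auto
  have holf: "(\<lambda>s. \<Sum>n<N. f n s) holomorphic_on A" for N A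
    unfolding f_def by (intro holomorphic_intros) auto
  have holD: "D holomorphic_on ball 0 1"
  proof (rule holomorphic_uniform_sequence[OF _ holf])
    fix s :: complex assume "s \<in> ball 0 1"
    then obtain d where "d > 0" "cball s d \<subseteq> ball 0 1" by (meson open_ball open_contains_cball)
    then show "\<exists>d>0. cball s d \<subseteq> ball 0 1 \<and> uniform_limit (cball s d) (\<lambda>N s. \<Sum>n<N. f n s) D
        sequentially"
      using uniform_limit_on_subset[OF ul'] by blast
  qed auto
  have f': "(f n has_field_derivative (- s) ^ n / of_nat (Suc n)) (at s)" for n s
  proof -
    have "((\<lambda>s. (- 1) ^ n / of_nat (Suc n) ^ 2 * s ^ Suc n) has_field_derivative
        (- 1) ^ n / of_nat (Suc n) ^ 2 * (of_nat (Suc n) * s ^ n)) (at s)"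
      by (intro DERIV_cmult) (auto intro!: derivative_eq_intros simp del: power_Suc of_nat_Suc)
    then show ?thesis
      unfolding f_def by (simp add: power_minus[of s] power2_eq_square mult_ac del: of_nat_Suc
          power_Suc)
  qed
  have derivD: "deriv D s = Ln1_quot s" if s: "s \<in> ball 0 1" for s
  proof -
    have "(\<lambda>N. deriv (\<lambda>s. \<Sum>n<N. f n s) s) \<longlonglongrightarrow> deriv D s"
      using higher_deriv_complex_uniform_limit[OF ul' _ _ _ s, of 1] holf by simp
    moreover have "deriv (\<lambda>s. \<Sum>n<N. f n s) s = (\<Sum>n<N. (- s) ^ n / of_nat (Suc n))" for N
      by (rule DERIV_imp_deriv) (intro DERIV_sum f')
    ultimately have 1: "(\<lambda>n. (- s) ^ n / of_nat (Suc n)) sums deriv D s"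
      unfolding sums_def by simp
    show ?thesis
    proof (cases "s = 0")
      case True
      have "(\<lambda>n. (- s) ^ n / of_nat (Suc n)) sums (\<Sum>n\<in>{0}. (- s) ^ n / of_nat (Suc n))"
        by (rule sums_finite) (auto simp: True)
      with 1 show ?thesis using True by (auto simp: Ln1_quot_def dest: sums_unique2)
    next
      case False
      have "(\<lambda>n. (- 1) ^ Suc n / of_nat n * s ^ n) sums Ln (1 + s)"
        using s by (intro Ln_series) auto
      then have "(\<lambda>n. (- 1) ^ Suc (Suc n) / of_nat (Suc n) * s ^ Suc n) sums Ln (1 + s)"
        by (subst sums_Suc_iff) simp
      from sums_divide[OF this, of s] False
      have "(\<lambda>n. (- s) ^ n / of_nat (Suc n)) sums (Ln (1 + s) / s)"
        by (simp add: power_minus[of s])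
      with 1 False show ?thesis by (auto simp: Ln1_quot_def dest: sums_unique2)
    qed
  qed
  have "\<exists>c. \<forall>s\<in>ball 0 1. L s - D s = c"
  proof (rule has_field_derivative_zero_constant)
    fix s :: complex assume s: "s \<in> ball 0 1"
    then have "Re s > - 1" using abs_Re_le_cmod[of s] by simp
    then have "((\<lambda>s. L s - D s) has_field_derivative Ln1_quot s - deriv D s) (at s)"
      using holD s by (intro derivative_intros L holomorphic_derivI[of _ "ball 0 1"]) auto
    then show "((\<lambda>s. L s - D s) has_field_derivative 0) (at s within ball 0 1)"
      unfolding derivD[OF s] diff_self by (rule has_field_derivative_at_within)
  qed auto
  then obtain c where c: "\<And>s. s \<in> ball 0 1 \<Longrightarrow> L s - D s = c" by blast
  have "D 0 = 0" by (simp add: D_def f_def)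
  with c[of 0] have c_eq: "c = L 0" by simp
  define u where "u n = complex_of_real (real n / real (Suc n))" for n
  have u_lim: "u \<longlonglongrightarrow> of_real 1"
    unfolding u_def by (intro tendsto_of_real LIMSEQ_n_over_Suc_n)
  have u_ball: "u n \<in> ball 0 1" for n by (simp add: u_def norm_divide del: of_real_divide)
  have "(\<lambda>n. D (u n)) \<longlonglongrightarrow> D 1"
    using u_ball u_lim by (intro continuous_on_tendsto_compose[OF contD] always_eventually)
        (auto intro: less_imp_le)
  moreover have "(\<lambda>n. L (u n)) \<longlonglongrightarrow> L 1"
    using u_lim by (intro isCont_tendsto_compose[OF DERIV_isCont[OF L]]) simp_all
  ultimately have "(\<lambda>n. L (u n) - D (u n)) \<longlonglongrightarrow> L 1 - D 1" by (rule tendsto_diff[rotated])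
  then have "L 1 - D 1 = L 0" using c[OF u_ball] c_eq by (simp add: LIMSEQ_const_iff)
  moreover have "D 1 = of_real (pi ^ 2 / 12)"
  proof -
    have "f n 1 = of_real ((- 1) ^ n / real (Suc n) ^ 2)" for n by (simp add: f_def)
    then have "(\<lambda>n. f n 1) sums of_real (pi ^ 2 / 12)"
      using sums_of_real[OF alternating_inverse_squares_sums] by (simp only:)
    then show ?thesis by (simp add: D_def sums_iff)
  qed
  ultimately show ?thesis by (simp add: algebra_simps)
qed

text \<open>Both sums are Riemann sums for \<open>Ln (1 + s) / s\<close>, along the segments from 0
  to \<open>x\<close> and to \<open>1 / x\<close>. With a primitive \<open>L\<close>, the derivative
  of \<open>L y + L (1 / y) - (Ln y)\<^sup>2 / 2\<close> vanishes on the right half-plane by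
  \<open>Ln_1_plus_inverse\<close>. Its constant value is found at \<open>y = 1\<close>, which
  contributes twice \<open>pi ^ 2 / 12\<close>.\<close>

lemma sum_Ln_over_n_limit:
  assumes x: "Re x > 0"
  shows "(\<lambda>M. (\<Sum>n=1..M. Ln (1 + of_nat n * x / of_nat M) / of_nat n)
            + (\<Sum>n=1..M. Ln (1 + of_nat n * (1 / x) / of_nat M) / of_nat n))
          \<longlonglongrightarrow> of_real (pi ^ 2 / 6) + (Ln x)\<^sup>2 / 2"
proof -
  define S where "S = {s. Re s > - 1}"
  have S: "convex S" "open S" by (auto simp: S_def convex_halfspace_Re_gt open_halfspace_Re_gt)
  obtain L where "\<And>s. s \<in> S \<Longrightarrow> (L has_field_derivative Ln1_quot s) (at s within S)"
    using holomorphic_convex_primitive'[OF S] Ln1_quot_holomorphic unfolding S_def by blast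
  then have L: "(L has_field_derivative Ln1_quot s) (at s)" if "s \<in> S" for s
    using that S(2) by (metis at_within_open)
  have riemann: "(\<lambda>M. \<Sum>n=1..M. Ln (1 + of_nat n * y / of_nat M) / of_nat n) \<longlonglongrightarrow> L y - L 0" if y:
      "Re y > 0" for y
  proof -
    have "(\<lambda>M. \<Sum>n=1..M. Ln1_quot (of_nat n * y / of_nat M) * (y / of_nat M)) \<longlonglongrightarrow> L y - L 0"
    proof (rule riemann_sum_segment[OF S(2) _ L])
      show "closed_segment 0 y \<subseteq> S"
        using y S by (intro closed_segment_subset) (auto simp: S_def)
    qed
    moreover have "(\<Sum>n=1..M. Ln1_quot (of_nat n * y / of_nat M) * (y / of_nat M))
        = (\<Sum>n=1..M. Ln (1 + of_nat n * y / of_nat M) / of_nat n)" for M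
    proof (rule sum.cong)
      fix n assume "n \<in> {1..M}"
      moreover have "y \<noteq> 0" using y by auto
      ultimately show "Ln1_quot (of_nat n * y / of_nat M) * (y / of_nat M)
          = Ln (1 + of_nat n * y / of_nat M) / of_nat n"
        by (auto simp: Ln1_quot_def)
    qed auto
    ultimately show ?thesis by simp
  qed
  have "\<exists>c. \<forall>y\<in>{s. Re s > 0}. L y + L (1 / y) - (Ln y)\<^sup>2 / 2 = c"
  proof (rule has_field_derivative_zero_constant)
    show "convex {s. Re s > 0}" by (rule convex_halfspace_Re_gt)
    fix y assume "y \<in> {s. Re s > 0}"
    then have y: "Re y > 0" by simp
    have y0: "y \<noteq> 0" "y \<notin> \<real>\<^sub>\<le>\<^sub>0" using Re_pos_not_nonpos_Reals[OF y] y by auto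
    have L1: "(L has_field_derivative Ln1_quot y) (at y)" using y by (intro L) (simp add: S_def)
    have L2: "(L has_field_derivative Ln1_quot (1 / y)) (at (1 / y))"
      using Re_inverse_pos[OF y] by (intro L) (simp add: S_def)
    have "((\<lambda>y. 1 / y) has_field_derivative - (1 / y ^ 2)) (at y)"
      using y0 by (auto intro!: derivative_eq_intros simp: power2_eq_square)
    from DERIV_chain2[OF L2 this]
    have "((\<lambda>y. L y + L (1 / y) - (Ln y)\<^sup>2 / 2) has_field_derivative
       Ln1_quot y + Ln1_quot (1 / y) * - (1 / y ^ 2) - Ln y / y) (at y)"
      using y0 by (auto intro!: derivative_eq_intros L1 simp: field_simps)
    moreover have "Ln1_quot y + Ln1_quot (1 / y) * - (1 / y ^ 2) - Ln y / y = 0"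
    proof -
      have "Ln1_quot y = Ln (1 + y) / y" "Ln1_quot (1 / y) = (Ln (1 + y) - Ln y) * y"
        using y0 Ln_1_plus_inverse[OF y] by (auto simp: Ln1_quot_def)
      then show ?thesis using y0 by (simp only:) (simp add: power2_eq_square field_simps)
    qed
    ultimately have "((\<lambda>y. L y + L (1 / y) - (Ln y)\<^sup>2 / 2) has_field_derivative 0) (at y)"
        by (simp only:)
    then show "((\<lambda>y. L y + L (1 / y)
        - (Ln y)\<^sup>2 / 2) has_field_derivative 0) (at y within {s. Re s > 0})"
      by (rule has_field_derivative_at_within)
  qed
  then obtain c where c: "\<And>y. Re y > 0 \<Longrightarrow> L y + L (1 / y) - (Ln y)\<^sup>2 / 2 = c" by blast
  have "L 1 - L 0 = of_real (pi ^ 2 / 12)"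
    by (rule Ln1_quot_primitive_at_1) (rule L, simp add: S_def)
  then have "2 * (L 1 - L 0) = of_real (pi ^ 2 / 6)" by (simp only:) simp
  then have "2 * L 1 = 2 * L 0 + of_real (pi ^ 2 / 6)" unfolding right_diff_distrib diff_eq_eq
      by (simp only: add.commute)
  then have "c = 2 * L 0 + of_real (pi ^ 2 / 6)" using c[of 1] by simp
  with c[OF x] have "L x + L (1 / x) - (Ln x)\<^sup>2 / 2 = 2 * L 0 + of_real (pi ^ 2 / 6)"
      by (simp only:)
  then have "(L x - L 0) + (L (1 / x) - L 0) = of_real (pi ^ 2 / 6) + (Ln x)\<^sup>2 / 2"
    unfolding diff_eq_eq by
        (simp only: add_diff_eq diff_add_eq diff_eq_eq mult_2 mult_2_right ac_simps)
  with tendsto_add[OF riemann[OF x] riemann[OF Re_inverse_pos[OF x]]] show ?thesis by (simp only:)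
qed

section \<open>The zeta function to the right of the imaginary axis\<close>

text \<open>For \<open>Re s > 1\<close> the last power is \<open>s - 1\<close> times the integral of
  \<open>t powr - s\<close> from \<open>M + 1\<close> to infinity, so it replaces the missing tail
  of the series. The cutoff \<open>Suc M\<close> keeps its base positive, and \<open>M = 0\<close>
  gives the value \<open>s\<close>, the leading term of \<open>zeta_reg\<close>.\<close>

definition zeta_trunc :: "nat \<Rightarrow> complex \<Rightarrow> complex" where
  "zeta_trunc M s = (s - 1) * (\<Sum>n=1..Suc M. of_nat n powr - s) + of_nat (Suc M) powr (1 - s)"

text \<open>
  By comparison with \<open>\<integral> t\<^bsup>- s\<^esup> dt\<close>, the truncations converge locally uniformly on \<open>Re s > 0\<close>,
  and the limit is the entire function \<open>(s - 1) \<zeta>(s)\<close> restricted to that half-plane. All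
  derivatives converge as well, which yields \<open>\<zeta>'\<close>, \<open>\<gamma>\<close> and \<open>\<gamma>\<^sub>1\<close> as limits of finite sums.
\<close>

definition zeta_reg :: "complex \<Rightarrow> complex" where
  "zeta_reg s = s + (\<Sum>n. zeta_trunc (Suc n) s - zeta_trunc n s)"

text \<open>The difference is \<open>s - 1\<close> times the integral of
  \<open>b powr - s - t powr - s\<close> over \<open>[a, b]\<close> with \<open>b = a + 1\<close>.
  The integrand is small by the mean value inequality, which gains one power of \<open>a\<close> and
  makes the differences summable for \<open>Re s > 0\<close>. The function \<open>f\<close> below is
  the primitive of this integrand, including the factor \<open>s - 1\<close>.\<close>

lemma zeta_trunc_diff_bound:
  assumes "Re s > 0"
  shows "norm (zeta_trunc (Suc n) s - zeta_trunc n s)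
      \<le> norm (s - 1) * norm s * real (Suc n) powr (- Re s - 1)"
proof -
  define a b where "a = real (Suc n)" and "b = real (Suc (Suc n))"
  define S where "S = closed_segment (of_real a) (of_real b :: complex)"
  have ab: "a > 0" "b = a + 1" by (auto simp: a_def b_def)
  have S: "convex S" "of_real a \<in> S" "of_real b \<in> S" by (auto simp: S_def)
  have seg: "\<exists>r. t = of_real r \<and> a \<le> r \<and> r \<le> b" if "t \<in> S" for t
  proof -
    from that obtain u where "0 \<le> u" "u \<le> 1" "t = (1 - u) *\<^sub>R of_real a + u *\<^sub>R of_real b"
      by (auto simp: S_def closed_segment_def)
    then show ?thesis
      by (intro exI[of _ "a + u"]) (auto simp: ab scaleR_conv_of_real algebra_simps)
  qed
  have dist: "norm (t - of_real b) \<le> 1" if "t \<in> S" for t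
  proof -
    from seg[OF that] obtain r where "t = of_real r" "a \<le> r" "r \<le> b" by blast
    then show ?thesis using ab(2) by (simp del: of_real_add flip: of_real_diff)
  qed
  have nn: "t \<notin> \<real>\<^sub>\<le>\<^sub>0" if "t \<in> S" for t
    using seg[OF that] ab by auto
  have deriv_powr: "((\<lambda>t. t powr c) has_field_derivative c * t powr (c - 1)) (at t within S)"
    if "t \<in> S" for t c
    using nn[OF that] by (auto intro!: derivative_eq_intros)
  have inner: "norm (t powr - s - of_real b powr - s) \<le> norm s * a powr (- Re s - 1)" if t: "t \<in> S"
      for t
  proof -
    have "norm (t powr - s - of_real b powr - s)
        \<le> (norm s * a powr (- Re s - 1)) * norm (t - of_real b)"
    proof (rule field_differentiable_bound[OF S(1) deriv_powr])
      fix u assume "u \<in> S"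
      from seg[OF this] obtain r where r: "u = of_real r" "a \<le> r" by blast
      show "norm (- s * u powr (- s - 1)) \<le> norm s * a powr (- Re s - 1)"
        using r ab assms
        by (auto simp: norm_mult norm_powr_real_powr intro!: mult_left_mono powr_mono2')
    qed (use t S in auto)
    also have "\<dots> \<le> (norm s * a powr (- Re s - 1)) * 1"
      using dist[OF t] by (intro mult_left_mono) auto
    finally show ?thesis by simp
  qed
  define f where "f t = t powr (1 - s) + (s - 1) * of_real b powr (- s) * t" for t
  have "norm (f (of_real b) - f (of_real a))
      \<le> (norm (s - 1) * (norm s * a powr (- Re s - 1))) * norm (of_real b - of_real a :: complex)"
  proof (rule field_differentiable_bound[OF S(1)])
    fix t assume t: "t \<in> S"
    show "(f has_field_derivative (s - 1) * (of_real b powr - s - t powr - s)) (at t within S)"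
      unfolding f_def using nn[OF t]
      by (auto intro!: derivative_eq_intros deriv_powr[OF t] simp: algebra_simps)
    show "norm ((s - 1) * (of_real b powr - s - t powr - s))
        \<le> norm (s - 1) * (norm s * a powr (- Re s - 1))"
      unfolding norm_mult using inner[OF t]
          by (intro mult_left_mono) (auto simp: norm_minus_commute)
  qed (use S in auto)
  also have "f (of_real b) - f (of_real a) = zeta_trunc (Suc n) s - zeta_trunc n s"
    unfolding f_def zeta_trunc_def ab(2) by (simp add: a_def algebra_simps)
  also have "norm (of_real b - of_real a :: complex) = 1" by (simp add: ab)
  finally show ?thesis by (simp add: a_def mult_ac)
qed

lemma zeta_trunc_eq_sum: "zeta_trunc M s = s + (\<Sum>n<M. zeta_trunc (Suc n) s - zeta_trunc n s)"
  by (subst sum_lessThan_telescope) (simp add: zeta_trunc_def)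

text \<open>On a disc of radius \<open>Re s / 2\<close> all real parts are at least
  \<open>Re s / 2\<close>, so one exponent \<open>- Re s / 2 - 1\<close> majorises every
  term.\<close>

lemma zeta_trunc_uniform_limit:
  assumes "Re s > 0"
  shows "uniform_limit (cball s (Re s / 2)) zeta_trunc zeta_reg sequentially"
proof -
  define A where "A = cball s (Re s / 2)"
  define r where "r = norm s + Re s / 2"
  have "uniform_limit A (\<lambda>M z. \<Sum>n<M. zeta_trunc (Suc n) z - zeta_trunc n z)
          (\<lambda>z. \<Sum>n. zeta_trunc (Suc n) z - zeta_trunc n z) sequentially"
  proof (rule Weierstrass_m_test)
    fix n z assume "z \<in> A"
    then have z: "norm (s - z) \<le> Re s / 2" by (simp add: A_def dist_norm)
    have Re: "Re z \<ge> Re s / 2" using z complex_Re_le_cmod[of "s - z"] by simp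
    have nz: "norm z \<le> r"
      using z norm_triangle_ineq3[of s z] by (simp add: r_def norm_minus_commute)
    have "norm (z - 1) \<le> r + 1" using nz norm_triangle_ineq4[of z 1] by simp
    then have "norm (z - 1) * norm z * real (Suc n) powr (- Re z - 1)
        \<le> (r + 1) * r * real (Suc n) powr (- Re s / 2 - 1)"
      using nz Re assms by (intro mult_mono powr_mono) (auto simp: r_def)
    with zeta_trunc_diff_bound[of z n] Re assms
    show "norm (zeta_trunc (Suc n) z - zeta_trunc n z)
        \<le> (r + 1) * r * real (Suc n) powr (- Re s / 2 - 1)"
      by simp
  next
    have "summable (\<lambda>n. real n powr (- Re s / 2 - 1))"
      using assms by (subst summable_real_powr_iff) auto
    then have "summable (\<lambda>n. real (Suc n) powr (- Re s / 2 - 1))"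
      by (rule summable_Suc_iff[THEN iffD2])
    then show "summable (\<lambda>n. (r + 1) * r * real (Suc n) powr (- Re s / 2 - 1))"
      by (rule summable_mult)
  qed
  then have "uniform_limit A (\<lambda>M z. z
      + (\<Sum>n<M. zeta_trunc (Suc n) z - zeta_trunc n z)) zeta_reg sequentially"
    unfolding zeta_reg_def by (intro uniform_limit_intros)
  then show ?thesis unfolding A_def zeta_trunc_eq_sum[symmetric] .
qed

lemma zeta_trunc_holomorphic: "zeta_trunc M holomorphic_on A"
  unfolding zeta_trunc_def by (auto intro!: holomorphic_intros)

lemma zeta_reg_holomorphic: "zeta_reg holomorphic_on {s. Re s > 0}"
proof (rule holomorphic_uniform_sequence)
  fix s assume "s \<in> {s. Re s > 0}"
  then have s: "Re s > 0" by simp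
  have "cball s (Re s / 2) \<subseteq> {s. Re s > 0}"
  proof
    fix z assume "z \<in> cball s (Re s / 2)"
    then show "z \<in> {s. Re s > 0}"
      using s complex_Re_le_cmod[of "s - z"] by (simp add: dist_norm)
  qed
  then show "\<exists>d>0. cball s d \<subseteq> {s. Re s > 0} \<and> uniform_limit (cball s d) zeta_trunc zeta_reg
      sequentially"
    using s zeta_trunc_uniform_limit[OF s] by (intro exI[of _ "Re s / 2"]) auto
qed (auto intro: zeta_trunc_holomorphic open_halfspace_Re_gt)

lemma zeta_trunc_higher_deriv_limit:
  assumes "Re s > 0"
  shows "(\<lambda>M. (deriv ^^ m) (zeta_trunc M) s) \<longlonglongrightarrow> (deriv ^^ m) zeta_reg s"
proof (rule higher_deriv_complex_uniform_limit)
  show "uniform_limit (ball s (Re s / 2)) zeta_trunc zeta_reg sequentially"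
    using zeta_trunc_uniform_limit[OF assms] by (rule uniform_limit_on_subset) auto
qed (use assms in \<open>auto intro: zeta_trunc_holomorphic always_eventually\<close>)

section \<open>Zeta and its derivative as limits of finite sums\<close>

lemma summable_zeta_complex:
  assumes "Re s > 1"
  shows "summable (\<lambda>n. of_nat (Suc n) powr - s :: complex)"
proof (rule summable_norm_cancel)
  have "summable (\<lambda>n. real n powr - Re s)"
    using assms by (subst summable_real_powr_iff) auto
  then have "summable (\<lambda>n. real (Suc n) powr - Re s)" by (rule summable_Suc_iff[THEN iffD2])
  then show "summable (\<lambda>n. norm (of_nat (Suc n) powr - s :: complex))"
    by (simp add: norm_powr_real_powr del: of_nat_Suc)
qed

lemma of_nat_powr_tendsto_0:
  assumes "Re c < 0"
  shows "(\<lambda>n. of_nat (Suc n) powr c :: complex) \<longlonglongrightarrow> 0"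
proof -
  have "((\<lambda>x. x powr Re c) \<longlongrightarrow> 0) at_top"
    using assms filterlim_ident by (rule tendsto_neg_powr)
  then have "(\<lambda>n. real (Suc n) powr Re c) \<longlonglongrightarrow> 0"
    by (rule filterlim_compose)
        (use filterlim_real_sequentially filterlim_Suc filterlim_compose in blast)
  then show ?thesis
    by (subst tendsto_norm_zero_iff[symmetric]) (simp add: norm_powr_real_powr del: of_nat_Suc)
qed

lemma sum_zeta_partial_limit:
  assumes "Re s > 1"
  shows "(\<lambda>M. \<Sum>n=1..M. of_nat n powr - s) \<longlonglongrightarrow> (\<Sum>n. 1 / of_nat (Suc n) powr s :: complex)"
proof -
  have "(\<lambda>n. of_nat (Suc n) powr - s :: complex) sums (\<Sum>n. of_nat (Suc n) powr - s)"
    using summable_zeta_complex[OF assms] by (rule summable_sums)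
  then have "(\<lambda>M. \<Sum>n<M. of_nat (Suc n) powr - s) \<longlonglongrightarrow> (\<Sum>n. of_nat (Suc n) powr - s :: complex)"
    by (simp only: sums_def)
  moreover have "(\<Sum>n<M. of_nat (Suc n) powr - s :: complex) = (\<Sum>n=1..M. of_nat n powr - s)" for M
    by (rule sum.reindex_bij_witness[of _ "\<lambda>n. n - 1" Suc]) auto
  ultimately show ?thesis by (simp add: powr_minus_divide)
qed

lemma zeta_reg_eq_series:
  assumes "Re s > 1"
  shows "zeta_reg s = (s - 1) * (\<Sum>n. 1 / of_nat (Suc n) powr s)"
proof -
  have "(\<lambda>M. (s - 1) * (\<Sum>n=1..Suc M. of_nat n powr - s) + of_nat (Suc M) powr (1 - s)) \<longlonglongrightarrow>
      (s - 1) * (\<Sum>n. 1 / of_nat (Suc n) powr s) + 0"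
    using assms
    by (intro tendsto_intros of_nat_powr_tendsto_0 LIMSEQ_Suc[OF sum_zeta_partial_limit]) auto
  moreover have "(\<lambda>M. zeta_trunc M s) \<longlonglongrightarrow> zeta_reg s"
    using zeta_trunc_higher_deriv_limit[of s 0] assms by simp
  ultimately show ?thesis
    unfolding zeta_trunc_def using LIMSEQ_unique by fastforce
qed

text \<open>The quotient is a \<open>zeta_continuation\<close> with \<open>c = 0\<close>, so
  uniqueness of continuation ties the abstract \<open>zeta\<close> to the truncations.\<close>

lemma zeta_eq_zeta_reg:
  assumes "Re s > 0" "s \<noteq> 1"
  shows "zeta s = zeta_reg s / (s - 1)"
proof (rule zeta_eqI[where c = 0])
  show "zeta_continuation 0 (\<lambda>s. zeta_reg s / (s - 1))"
    unfolding zeta_continuation_def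
    by (auto intro!: holomorphic_intros holomorphic_on_subset[OF zeta_reg_holomorphic]
        simp: zeta_reg_eq_series)
qed (use assms in auto)

lemma zeta_partial_limit:
  assumes "Re s > 1"
  shows "(\<lambda>M. \<Sum>n=1..M. of_nat n powr - s) \<longlonglongrightarrow> zeta s"
proof -
  have "s \<noteq> 1" using assms by auto
  then show ?thesis
    using sum_zeta_partial_limit[OF assms] zeta_eq_zeta_reg[of s] zeta_reg_eq_series[OF assms] assms
        by simp
qed

lemma has_field_derivative_of_nat_powr:
  assumes "n > 0" and f: "(f has_field_derivative f') (at s)"
  shows "((\<lambda>s. of_nat n powr f s :: complex) has_field_derivative
           of_real (ln (real n)) * of_nat n powr f s * f') (at s)"
  using DERIV_chain2[OF has_field_derivative_powr_right[of "of_nat n" "f s"] f] assms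
  by simp

lemma deriv_zeta_trunc:
  "deriv (zeta_trunc M) = (\<lambda>s. (\<Sum>n=1..Suc M. of_nat n powr - s)
     - (s - 1) * (\<Sum>n=1..Suc M. of_real (ln (real n)) * of_nat n powr - s)
     - of_real (ln (real (Suc M))) * of_nat (Suc M) powr (1 - s))"
  unfolding zeta_trunc_def
  by (intro ext DERIV_imp_deriv)
    (auto intro!: derivative_eq_intros has_field_derivative_of_nat_powr
      simp: sum_negf mult_ac simp del: of_nat_Suc sum.cl_ivl_Suc)

lemma deriv2_zeta_trunc_1:
  "(deriv ^^ 2) (zeta_trunc M) 1
      = of_real (ln (real (Suc M)) ^ 2) - 2 * (\<Sum>n=1..Suc M. of_real (ln (real n) / real n))"
proof -
  have "deriv (deriv (zeta_trunc M)) 1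
      = of_real (ln (real (Suc M)) ^ 2) - 2 *
      (\<Sum>n=1..Suc M. of_real (ln (real n)) * of_nat n powr - 1)"
    unfolding deriv_zeta_trunc
    by (rule DERIV_imp_deriv)
      (auto intro!: derivative_eq_intros has_field_derivative_of_nat_powr simp: sum_negf mult_ac
          power2_eq_square simp del: of_nat_Suc sum.cl_ivl_Suc)
  also have "(\<Sum>n=1..Suc M. of_real (ln (real n)) * of_nat n powr - 1 :: complex)
      = (\<Sum>n=1..Suc M. of_real (ln (real n) / real n))"
    by (intro sum.cong) (auto simp: powr_minus_divide)
  finally show ?thesis by (simp add: numeral_2_eq_2)
qed

text \<open>The derivative of the truncation is \<open>H - (s - 1) * L - E\<close>, where
  \<open>L\<close> is the wanted sum. As \<open>H\<close> tends to \<open>zeta s\<close> and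
  \<open>E\<close> to 0, one can solve for the limit of \<open>L\<close>; the quotient rule for
  \<open>zeta_reg s / (s - 1)\<close> identifies it.\<close>

lemma deriv_zeta_partial_limit:
  assumes "Re s > 1"
  shows "(\<lambda>M. \<Sum>n=1..M. of_real (ln (real n)) * of_nat n powr - s) \<longlonglongrightarrow> - deriv zeta s"
proof -
  have s: "s \<noteq> 1" "Re s > 0" using assms by auto
  define L where "L M = (\<Sum>n=1..Suc M. of_real (ln (real n)) * of_nat n powr - s)" for M
  define H where "H M = (\<Sum>n=1..Suc M. of_nat n powr - s)" for M
  define E where "E M = of_real (ln (real (Suc M))) * of_nat (Suc M) powr (1 - s)" for M
  have "(\<lambda>M. deriv (zeta_trunc M) s) \<longlonglongrightarrow> deriv zeta_reg s"
    using zeta_trunc_higher_deriv_limit[of s 1] s by simp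
  then have D: "(\<lambda>M. H M - (s - 1) * L M - E M) \<longlonglongrightarrow> deriv zeta_reg s"
    unfolding deriv_zeta_trunc H_def L_def E_def .
  have H: "H \<longlonglongrightarrow> zeta s"
    unfolding H_def using LIMSEQ_Suc[OF zeta_partial_limit[OF assms]] .
  have "(\<lambda>n. Ln (of_nat n) / of_nat n powr (s - 1)) \<longlonglongrightarrow> 0"
    using assms by (intro lim_Ln_over_power) auto
  then have "(\<lambda>n. Ln (of_nat (Suc n)) / of_nat (Suc n) powr (s - 1)) \<longlonglongrightarrow> 0"
    by (rule LIMSEQ_Suc)
  moreover have "Ln (of_nat (Suc n)) / of_nat (Suc n) powr (s - 1) = E n" for n
    using powr_minus_divide[of "of_nat (Suc n)" "s - 1"] by (simp add: E_def del: of_nat_Suc)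
  ultimately have E: "E \<longlonglongrightarrow> 0" by simp
  have "(\<lambda>M. (H M - E M - (H M - (s - 1) * L M - E M)) / (s - 1))
      \<longlonglongrightarrow> (zeta s - 0 - deriv zeta_reg s) / (s - 1)"
    using s by (intro tendsto_intros D H E) auto
  then have "L \<longlonglongrightarrow> (zeta s - deriv zeta_reg s) / (s - 1)"
    using s by simp
  moreover have "deriv zeta s = (deriv zeta_reg s - zeta s) / (s - 1)"
  proof -
    have op: "open {s. Re s > 0}" by (rule open_halfspace_Re_gt)
    have "(zeta_reg has_field_derivative deriv zeta_reg s) (at s)"
      using zeta_reg_holomorphic op s by (intro holomorphic_derivI) auto
    then have "((\<lambda>s. zeta_reg s / (s - 1)) has_field_derivative (deriv zeta_reg s - zeta s) / (s
        - 1)) (at s)"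
      using s by (auto intro!: derivative_eq_intros simp: zeta_eq_zeta_reg field_simps)
    then have "(zeta has_field_derivative (deriv zeta_reg s - zeta s) / (s - 1)) (at s)"
    proof (rule DERIV_cong_ev[THEN iffD1, rotated -1])
      have "eventually (\<lambda>s. s \<in> {s. Re s > 0} - {1}) (nhds s)"
        using s op by (intro eventually_nhds_in_open) (auto simp: open_delete)
      then show "\<forall>\<^sub>F x in nhds s. zeta_reg x / (x - 1) = zeta x"
        by eventually_elim (auto simp: zeta_eq_zeta_reg)
    qed auto
    then show ?thesis by (rule DERIV_imp_deriv)
  qed
  ultimately have "L \<longlonglongrightarrow> - deriv zeta s" by (simp add: minus_divide_left)
  then show ?thesis unfolding L_def by (rule LIMSEQ_imp_Suc)
qed

section \<open>Laurent coefficients of zeta at 1\<close>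

lemma zeta_reg_1: "zeta_reg 1 = 1"
proof -
  have "(\<lambda>M. zeta_trunc M 1) \<longlonglongrightarrow> zeta_reg 1"
    using zeta_trunc_higher_deriv_limit[of 1 0] by simp
  moreover have "zeta_trunc M 1 = 1" for M by (simp add: zeta_trunc_def del: of_nat_Suc)
  ultimately show ?thesis by (simp add: LIMSEQ_const_iff)
qed

lemma deriv_zeta_reg_1: "deriv zeta_reg 1 = euler_mascheroni"
proof -
  have "(\<lambda>M. deriv (zeta_trunc M) 1) \<longlonglongrightarrow> deriv zeta_reg 1"
    using zeta_trunc_higher_deriv_limit[of 1 1] by simp
  moreover have "deriv (zeta_trunc M) 1 = of_real (harm (Suc M) - ln (of_nat (Suc M)))" for M
    unfolding deriv_zeta_trunc by (simp add: harm_def powr_minus del: of_nat_Suc sum.cl_ivl_Suc)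
  moreover have "(\<lambda>M. of_real (harm (Suc M) - ln (of_nat (Suc M)))) \<longlonglongrightarrow> (euler_mascheroni :: complex)"
    by (rule LIMSEQ_Suc[OF euler_mascheroni_LIMSEQ_of_real])
  ultimately show ?thesis using LIMSEQ_unique by auto
qed

text \<open>Second order Taylor expansion of \<open>zeta_reg\<close> at 1, divided by
  \<open>s - 1\<close>. The third derivative is bounded on a compact disc inside the
  half-plane.\<close>

lemma zeta_Laurent_1:
  "(\<lambda>s. zeta s - (1 / (s - 1) + euler_mascheroni - (- (deriv ^^ 2) zeta_reg 1 / 2) * (s - 1)))
     \<in> O[at 1](\<lambda>s. (s - 1)\<^sup>2)"
proof -
  define S where "S = cball (1::complex) (1/2)"
  define D where "D i = (deriv ^^ i) zeta_reg" for i
  define H where "H = {s. Re s > 0}"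
  have H: "open H" unfolding H_def by (rule open_halfspace_Re_gt)
  have SH: "S \<subseteq> H"
  proof
    fix z assume "z \<in> S"
    then show "z \<in> H"
      using complex_Re_le_cmod[of "1 - z"] by (simp add: dist_norm S_def H_def)
  qed
  have holD: "D i holomorphic_on H" for i
    unfolding D_def using zeta_reg_holomorphic H
        by (intro holomorphic_higher_deriv) (auto simp: H_def)
  have "bounded (D 3 ` S)"
    using holD[of 3] SH by (intro compact_imp_bounded compact_continuous_image)
      (auto simp: S_def intro: holomorphic_on_imp_continuous_on continuous_on_subset)
  then obtain B where B: "\<And>s. s \<in> S \<Longrightarrow> norm (D 3 s) \<le> B"
    by (auto simp: bounded_iff)
  have taylor: "norm (zeta_reg s - (1 + euler_mascheroni * (s - 1) + D 2 1 / 2 * (s - 1) ^ 2))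
      \<le> B * norm (s - 1) ^ 3 / 2"
    if "s \<in> S" for s
  proof -
    have "norm (D 0 s - (\<Sum>i\<le>2. D i 1 * (s - 1) ^ i / fact i)) \<le> B * norm (s - 1) ^ Suc 2 / fact 2"
    proof (rule complex_Taylor[where S = S])
      fix i x assume "x \<in> S"
      then have "(D i has_field_derivative deriv (D i) x) (at x)"
        using holD H SH by (intro holomorphic_derivI[of _ H]) auto
      then show "(D i has_field_derivative D (Suc i) x) (at x within S)"
        by (auto simp: D_def intro: DERIV_subset)
    qed (use that B in \<open>auto simp: S_def numeral_3_eq_3 numeral_2_eq_2\<close>)
    then show ?thesis
      by (simp add: numeral_2_eq_2 numeral_3_eq_3) (simp add: D_def zeta_reg_1 deriv_zeta_reg_1)
  qed
  show ?thesis
  proof (rule bigoI[where c = "B / 2"])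
    have "eventually (\<lambda>s. s \<in> ball 1 (1/2) - {1}) (at (1::complex))"
      by (intro eventually_at_in_open) auto
    then show "\<forall>\<^sub>F s in at 1. norm (zeta s
        - (1 / (s - 1) + euler_mascheroni - (- (deriv ^^ 2) zeta_reg 1 / 2) * (s - 1)))
       \<le> B / 2 * norm ((s - 1)\<^sup>2)"
    proof eventually_elim
      case (elim s)
      then have s: "s \<in> S" "s \<noteq> 1" by (auto simp: S_def)
      then have "Re s > 0" using SH by (auto simp: H_def)
      note s = s this
      have "zeta s - (1 / (s - 1) + euler_mascheroni - (- (deriv ^^ 2) zeta_reg 1 / 2) * (s - 1))
         = (zeta_reg s - (1 + euler_mascheroni * (s - 1) + D 2 1 / 2 * (s - 1) ^ 2)) / (s - 1)"
      proof -
        have "a / w - (1 / w + g - - e / 2 * w) = (a - (1 + g * w + e / 2 * w ^ 2)) / w"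
          if "w \<noteq> 0" for a e g w :: complex
          using that by (simp add: field_simps power2_eq_square)
        from this[of "s - 1"] s show ?thesis unfolding zeta_eq_zeta_reg[OF s(3,2)] D_def by simp
      qed
      also have "norm \<dots> \<le> (B * norm (s - 1) ^ 3 / 2) / norm (s - 1)"
        unfolding norm_divide using taylor[OF s(1)] by (intro divide_right_mono) auto
      also have "\<dots> = B / 2 * norm ((s - 1)\<^sup>2)"
        using s by (simp add: norm_mult power2_eq_square power3_eq_cube)
      finally show ?case .
    qed
  qed
qed

text \<open>Two admissible constants differ by a \<open>c - d\<close> with
  \<open>(c - d) * (s - 1) = O((s - 1)\<^sup>2)\<close>; dividing by \<open>s - 1\<close> and
  letting \<open>s\<close> tend to 1 forces \<open>c = d\<close>. This makes the definite
  description meaningful.\<close>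

lemma stieltjes_1_eq: "stieltjes_1 = - (deriv ^^ 2) zeta_reg 1 / 2"
  unfolding stieltjes_1_def
proof (rule the_equality)
  fix c
  assume c: "(\<lambda>s. zeta s - (1 / (s - 1) + euler_mascheroni - c * (s - 1))) \<in> O[at 1](\<lambda>s. (s - 1)\<^sup>2)"
  define d where "d = - (deriv ^^ 2) zeta_reg 1 / 2"
  have "(\<lambda>s. (c - d) * (s - 1)) \<in> O[at 1](\<lambda>s. (s - 1)\<^sup>2)"
    using sum_in_bigo(2)[OF c zeta_Laurent_1] by (simp add: d_def algebra_simps)
  then obtain C where "eventually (\<lambda>s. norm ((c - d) * (s - 1)) \<le> C * norm ((s - 1)\<^sup>2)) (at 1)"
    by (elim landau_o.bigE)
  moreover have "eventually (\<lambda>s::complex. s \<noteq> 1) (at 1)" by (rule eventually_neq_at_within)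
  ultimately have "eventually (\<lambda>s::complex. norm (c - d) \<le> C * norm (s - 1)) (at 1)"
    by eventually_elim (auto simp: norm_mult norm_power power2_eq_square)
  moreover have "((\<lambda>s::complex. C * norm (s - 1)) \<longlongrightarrow> C * norm (1 - 1 :: complex)) (at 1)"
    by (intro tendsto_intros)
  ultimately have "norm (c - d) \<le> C * norm (1 - 1 :: complex)"
    by (intro tendsto_lowerbound[where F = "at (1::complex)"]) auto
  then have "c = d" by simp
  then show "c = - (deriv ^^ 2) zeta_reg 1 / 2" by (simp only: d_def)
qed (rule zeta_Laurent_1)

lemma stieltjes_1_limit:
  "(\<lambda>M. (\<Sum>n=1..M. of_real (ln (real n) / real n)) - of_real (ln (real M) ^ 2 / 2)) \<longlonglongrightarrow> stieltjes_1"
proof -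
  have "(\<lambda>M. - (deriv ^^ 2) (zeta_trunc M) 1 / 2) \<longlonglongrightarrow> - (deriv ^^ 2) zeta_reg 1 / 2"
    by (intro tendsto_intros zeta_trunc_higher_deriv_limit) auto
  then have "(\<lambda>M. (\<Sum>n=1..Suc M. of_real (ln (real n) / real n))
      - of_real (ln (real (Suc M)) ^ 2 / 2)) \<longlonglongrightarrow> stieltjes_1"
    unfolding deriv2_zeta_trunc_1 stieltjes_1_eq
        by (simp add: diff_divide_distrib del: of_nat_Suc sum.cl_ivl_Suc)
  then show ?thesis by (rule LIMSEQ_imp_Suc)
qed

section \<open>Reciprocity for truncated double sums\<close>

lemma partial_fraction_reciprocal:
  fixes x n m :: "'a :: field"
  assumes "n \<noteq> 0" "m \<noteq> 0" "m + n * x \<noteq> 0"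
  shows "1 / (n ^ k * (m + n * x))
      = (\<Sum>j<k. (- x) ^ j * (1 / m ^ Suc j) * (1 / n ^ (k - j))) + (- x) ^ k / (m ^ k * (m + n * x))"
proof (induction k)
  case (Suc k)
  define d where "d = m + n * x"
  have d: "d \<noteq> 0" using assms by (simp add: d_def)
  have "1 / (n ^ Suc k * d) = 1 / n * (1 / (n ^ k * d))" by simp
  also have "\<dots> = 1 / n * (\<Sum>j<k. (- x) ^ j * (1 / m ^ Suc j) * (1 / n ^ (k - j)))
      + (- x) ^ k / m ^ k * (1 / (n * d))"
    unfolding Suc.IH[folded d_def] by (simp add: distrib_left mult_ac)
  also have "1 / n * (\<Sum>j<k. (- x) ^ j * (1 / m ^ Suc j) * (1 / n ^ (k - j)))
      = (\<Sum>j<k. (- x) ^ j * (1 / m ^ Suc j) * (1 / n ^ (Suc k - j)))"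
    unfolding sum_distrib_left by (intro sum.cong) (auto simp: Suc_diff_le)
  also have "1 / (n * d) = 1 / m * (1 / n) + 1 / m * (- x / d)"
    using assms d by (simp add: field_simps) (simp add: d_def algebra_simps)
  finally show ?case by (simp add: d_def algebra_simps)
qed auto

definition power_sum :: "nat \<Rightarrow> nat \<Rightarrow> complex" where
  "power_sum j M = (\<Sum>n=1..M. 1 / of_nat n ^ j)"

definition recip_sum :: "nat \<Rightarrow> complex \<Rightarrow> nat \<Rightarrow> complex" where
  "recip_sum k x M = (\<Sum>n=1..M. \<Sum>m=1..M. 1 / (of_nat n ^ k * (of_nat m + of_nat n * x)))"

text \<open>In the last term of the partial fraction \<open>m\<close> has taken the place of
  \<open>n\<close>, and \<open>m + n * x = x * (n + m * (1 / x))\<close>. Both indices have the same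
  range, so exchanging them produces the sum for \<open>1 / x\<close>.\<close>

lemma recip_sum_reciprocity:
  assumes "Re x > 0"
  shows "recip_sum k x M
      = (\<Sum>j<k. (- x) ^ j * power_sum (Suc j) M * power_sum (k - j) M) + (- x) ^ k / x * recip_sum k
      (1 / x) M"
proof -
  have x0: "x \<noteq> 0" using assms by auto
  have "recip_sum k x M = (\<Sum>n=1..M. \<Sum>m=1..M.
      (\<Sum>j<k. (- x) ^ j * (1 / of_nat m ^ Suc j) * (1 / of_nat n ^ (k - j))) + (- x) ^ k / x *
          (1 / (of_nat m ^ k * (of_nat n + of_nat m * (1 / x)))))"
    unfolding recip_sum_def
  proof (intro sum.cong refl)
    fix n m assume "n \<in> {1..M}" "m \<in> {1..M}"
    then have nm: "of_nat n \<noteq> (0::complex)" "of_nat m \<noteq> (0::complex)" "n > 0" "m > 0" by auto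
    have "Re (of_nat m + of_nat n * x) > 0" using nm assms by (auto intro!: add_pos_nonneg)
    then have d: "of_nat m + of_nat n * x \<noteq> 0" by (rule Re_pos_nonzero)
    have "of_nat n + of_nat m * (1 / x) = (of_nat m + of_nat n * x) / x"
      using x0 by (simp add: field_simps)
    then have "(- x) ^ k / x * (1 / (of_nat m ^ k * (of_nat n + of_nat m * (1 / x))))
        = (- x) ^ k / (of_nat m ^ k * (of_nat m + of_nat n * x))"
      using x0 by (simp only:) simp
    then show "1 / (of_nat n ^ k * (of_nat m + of_nat n * x))
        = (\<Sum>j<k. (- x) ^ j * (1 / of_nat m ^ Suc j) * (1 / of_nat n ^ (k - j)))
       + (- x) ^ k / x * (1 / (of_nat m ^ k * (of_nat n + of_nat m * (1 / x))))"
      using partial_fraction_reciprocal[OF nm(1,2) d] by (simp only:)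
  qed
  also have "\<dots> = (\<Sum>n=1..M. \<Sum>m=1..M. \<Sum>j<k. (- x) ^ j * (1 / of_nat m ^ Suc j)
      * (1 / of_nat n ^ (k - j)))
      + (- x) ^ k / x * (\<Sum>n=1..M. \<Sum>m=1..M. 1 / (of_nat m ^ k * (of_nat n + of_nat m * (1 / x))))"
    by (simp only: sum.distrib sum_distrib_left)
  also have "(\<Sum>n=1..M. \<Sum>m=1..M. 1 / (of_nat m ^ k * (of_nat n + of_nat m * (1 / x))))
      = recip_sum k (1 / x) M"
    unfolding recip_sum_def by (rule sum.swap)
  also have "(\<Sum>n=1..M. \<Sum>m=1..M. \<Sum>j<k. (- x) ^ j * (1 / of_nat m ^ Suc j) * (1 / of_nat n ^ (k - j)))
      = (\<Sum>j<k. \<Sum>n=1..M. \<Sum>m=1..M. (- x) ^ j * (1 / of_nat m ^ Suc j) * (1 / of_nat n ^ (k - j)))"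
    by (subst sum.swap[of _ _ "{..<k}"], subst sum.swap[of _ "{..<k}"]) (rule refl)
  also have "\<dots> = (\<Sum>j<k. (- x) ^ j * power_sum (Suc j) M * power_sum (k - j) M)"
    unfolding power_sum_def
    by (intro sum.cong refl, subst sum.swap)
        (simp only: sum_product sum_distrib_left[symmetric] mult.assoc)
  finally show ?thesis .
qed

section \<open>Truncated sums through digamma remainders and elementary terms\<close>

definition digamma_rem_sum :: "nat \<Rightarrow> complex \<Rightarrow> nat \<Rightarrow> complex" where
  "digamma_rem_sum k x M = (\<Sum>n=1..M. 1 / of_nat n ^ k * digamma_rem (of_nat n * x))"

definition digamma_rem_tail :: "nat \<Rightarrow> complex \<Rightarrow> nat \<Rightarrow> complex" where
  "digamma_rem_tail k x M = (\<Sum>n=1..M. 1 / of_nat n ^ k * digamma_rem (of_nat n * x + of_nat M))"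

definition log_sum :: "nat \<Rightarrow> nat \<Rightarrow> complex" where
  "log_sum k M = (\<Sum>n=1..M. 1 / of_nat n ^ k * of_real (ln (real n)))"

definition ratio_sum :: "nat \<Rightarrow> complex \<Rightarrow> nat \<Rightarrow> complex" where
  "ratio_sum k x M = (\<Sum>n=1..M. 1 / of_nat n ^ k * Ln (1 + of_nat n * x / of_nat M))
     + 1 / 2 * (\<Sum>n=1..M. 1 / of_nat n ^ k * (1 / (of_nat n * x + of_nat M)))"

text \<open>The elementary part of \<open>recip_sum\<close>: the logarithms and the
  \<open>1 / (2 * z)\<close> terms at \<open>n * x + M\<close> minus those at \<open>n * x\<close>,
  with \<open>ln M\<close> and \<open>ln n\<close> split off.\<close>

definition main_part :: "nat \<Rightarrow> complex \<Rightarrow> nat \<Rightarrow> complex" where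
  "main_part k x M = of_real (ln (real M)) * power_sum k M + ratio_sum k x M - log_sum k M
     - Ln x * power_sum k M - power_sum (Suc k) M / (2 * x)"

lemma sum_inverse_Digamma:
  assumes "Re z > 0"
  shows "(\<Sum>m=1..M. 1 / (of_nat m + z)) = Digamma (z + of_nat M + 1) - Digamma (z + 1)"
proof (induction M)
  case (Suc M)
  have "Re (z + of_nat M + 1) > 0" using assms by simp
  then have "z + of_nat M + 1 \<noteq> 0" by (rule Re_pos_nonzero)
  from Digamma_plus1[OF this] Suc show ?case by (simp add: add_ac)
qed auto

lemma Digamma_plus1_phi:
  assumes "Re z > 0"
  shows "Digamma (z + 1) = digamma_rem z + Ln z + 1 / (2 * z)"
proof -
  have "1 / z = 1 / (2 * z) + 1 / (2 * z)" using Re_pos_nonzero[OF assms] by (simp add: field_simps)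
  then show ?thesis using Digamma_plus1[OF Re_pos_nonzero[OF assms]] by (simp add: digamma_rem_def)
qed

text \<open>Each inner sum telescopes to a difference of two digamma values. Pulling the positive
  real factors \<open>n\<close> and \<open>M\<close> out of the logarithms separates the divergent
  \<open>ln M\<close> from a function of \<open>n * x / M\<close>.\<close>

lemma recip_sum_eq:
  assumes x: "Re x > 0" and M: "M > 0"
  shows "recip_sum k x M = digamma_rem_tail k x M - digamma_rem_sum k x M + main_part k x M"
proof -
  have x0: "x \<noteq> 0" using x by auto
  have "recip_sum k x M
      = (\<Sum>n=1..M. 1 / of_nat n ^ k *
      (digamma_rem (of_nat n * x + of_nat M) - digamma_rem (of_nat n * x)
      + (of_real (ln (real M)) + Ln (1 + of_nat n * x / of_nat M) + 1 / 2 *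
          (1 / (of_nat n * x + of_nat M))
         - of_real (ln (real n)) - Ln x - 1 / of_nat n * (1 / (2 * x)))))"
    unfolding recip_sum_def
  proof (rule sum.cong)
    fix n assume "n \<in> {1..M}"
    then have n: "n > 0" by auto
    have Re: "Re (of_nat n * x) > 0" "Re (of_nat n * x + of_nat M) > 0"
      using n x by (auto intro!: add_pos_nonneg)
    have "(\<Sum>m=1..M. 1 / (of_nat n ^ k * (of_nat m + of_nat n * x)))
        = 1 / of_nat n ^ k * (\<Sum>m=1..M. 1 / (of_nat m + of_nat n * x))"
      by (simp add: sum_distrib_left)
    also have "(\<Sum>m=1..M. 1 / (of_nat m + of_nat n * x))
        = (digamma_rem (of_nat n * x + of_nat M) + Ln (of_nat n * x + of_nat M) + 1 /
        (2 * (of_nat n * x + of_nat M)))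
        - (digamma_rem (of_nat n * x) + Ln (of_nat n * x) + 1 / (2 * (of_nat n * x)))"
      unfolding sum_inverse_Digamma[OF Re(1)] Digamma_plus1_phi[OF Re(1)]
          Digamma_plus1_phi[OF Re(2)] ..
    also have "Ln (of_nat n * x) = of_real (ln (real n)) + Ln x"
      using n x0 by (rule Ln_of_nat_mult)
    also have "Ln (of_nat n * x + of_nat M)
        = of_real (ln (real M)) + Ln (1 + of_nat n * x / of_nat M)"
    proof -
      have "of_nat n * x + of_nat M = of_nat M * (1 + of_nat n * x / of_nat M)" using M
          by (simp add: field_simps)
      then show ?thesis using Ln_of_nat_mult[OF M Re_pos_nonzero[OF Re_1_plus_frac_pos[OF x]]]
          by simp
    qed
    also have "1 / (2 * (of_nat n * x + of_nat M)) = 1 / 2 * (1 / (of_nat n * x + of_nat M))"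
      by (simp only: times_divide_times_eq mult_1_left)
    also have "1 / (2 * (of_nat n * x)) = 1 / of_nat n * (1 / (2 * x))"
      by (simp add: mult_ac)
    finally show "(\<Sum>m=1..M. 1 / (of_nat n ^ k * (of_nat m + of_nat n * x)))
        = 1 / of_nat n ^ k * (digamma_rem (of_nat n * x + of_nat M) - digamma_rem (of_nat n * x)
      + (of_real (ln (real M)) + Ln (1 + of_nat n * x / of_nat M) + 1 / 2 *
          (1 / (of_nat n * x + of_nat M))
         - of_real (ln (real n)) - Ln x - 1 / of_nat n * (1 / (2 * x))))"
      by (simp only: algebra_simps)
  qed auto
  also have "\<dots> = digamma_rem_tail k x M - digamma_rem_sum k x M
      + (of_real (ln (real M)) * power_sum k M + ratio_sum k x M - log_sum k M
     - Ln x * power_sum k M - (\<Sum>n=1..M. 1 / of_nat n ^ k * (1 / of_nat n)) * (1 / (2 * x)))"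
    unfolding digamma_rem_tail_def digamma_rem_sum_def ratio_sum_def log_sum_def power_sum_def
    by (simp only: sum_distrib_left sum_distrib_right sum.distrib[symmetric]
        sum_subtractf[symmetric])
      (intro sum.cong refl, simp only: algebra_simps)
  also have "(\<Sum>n=1..M. 1 / of_nat n ^ k * (1 / of_nat n)) = power_sum (Suc k) M"
    unfolding power_sum_def by (intro sum.cong) (auto simp: mult_ac)
  finally show ?thesis by (simp add: main_part_def)
qed

text \<open>All arguments have modulus at least \<open>M\<close> and all weights are at most 1, so
  \<open>M\<close> terms of size \<open>16 / M ^ 2\<close> remain, even for
  \<open>k = 0\<close>.\<close>

lemma digamma_rem_tail_tendsto_0:
  assumes x: "Re x > 0"
  shows "digamma_rem_tail k x \<longlonglongrightarrow> 0"
proof (rule Lim_transform_bound[where g = "\<lambda>M. 16 / real M"])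
  show "(\<lambda>M. 16 / real M) \<longlonglongrightarrow> 0" by (rule lim_const_over_n)
  show "\<forall>\<^sub>F M in sequentially. norm (digamma_rem_tail k x M) \<le> norm (16 / real M)"
    using eventually_gt_at_top[of 0]
  proof eventually_elim
    case (elim M)
    have "norm (digamma_rem_tail k x M) \<le> (\<Sum>n=1..M. 16 / real M ^ 2)"
      unfolding digamma_rem_tail_def
    proof (rule sum_norm_le)
      fix n assume "n \<in> {1..M}"
      then have n: "n > 0" by auto
      define z where "z = of_nat n * x + of_nat M"
      have Re: "Re z \<ge> real M" using x by (simp add: z_def)
      then have nz: "norm z \<ge> real M" using complex_Re_le_cmod[of z] by linarith
      have "norm (digamma_rem z) \<le> 16 / norm z ^ 2"
        using elim Re nz by (intro digamma_rem_bound) auto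
      also have "\<dots> \<le> 16 / real M ^ 2"
        using elim nz by (intro divide_left_mono power_mono mult_pos_pos) auto
      finally have "norm (digamma_rem z) \<le> 16 / real M ^ 2" .
      moreover have "norm (1 / of_nat n ^ k :: complex) \<le> 1"
        using n by (simp add: norm_divide norm_power)
      ultimately have "norm (1 / of_nat n ^ k * digamma_rem z) \<le> 1 * (16 / real M ^ 2)"
        unfolding norm_mult by (intro mult_mono) auto
      then show "norm (1 / of_nat n ^ k * digamma_rem (of_nat n * x + of_nat M)) \<le> 16 / real M ^ 2"
        by (simp add: z_def)
    qed
    also have "\<dots> = 16 / real M" using elim by (simp add: power2_eq_square)
    finally show ?case by simp
  qed
qed

lemma digamma_rem_sum_tendsto_herglotz_F:
  assumes x: "Re x > 0"
  shows "digamma_rem_sum k x \<longlonglongrightarrow> herglotz_F (real k) 1 x"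
proof -
  define f where "f n = 1 / of_nat (Suc n) ^ k * digamma_rem (of_nat (Suc n) * x)" for n
  have x0: "x \<noteq> 0" using x by auto
  have "summable f"
  proof (rule summable_comparison_test_ev)
    \<comment> \<open>\<open>digamma_rem_bound\<close> asks for modulus at least 1, so it covers all
      but finitely many terms.\<close>
    have "\<forall>\<^sub>F n in sequentially. real (Suc n) \<ge> 1 / norm x"
      using filterlim_compose[OF filterlim_real_sequentially filterlim_Suc]
      unfolding filterlim_at_top by blast
    then show "\<forall>\<^sub>F n in sequentially. norm (f n) \<le> 16 / norm x ^ 2 * (1 / real (Suc n) ^ 2)"
    proof eventually_elim
      case (elim n)
      have "norm (digamma_rem (of_nat (Suc n) * x)) \<le> 16 / norm (of_nat (Suc n) * x) ^ 2"
        using elim x x0 by (intro digamma_rem_bound)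
            (auto simp: norm_mult field_simps simp del: of_nat_Suc)
      also have "\<dots> = 16 / norm x ^ 2 * (1 / real (Suc n) ^ 2)"
        by (simp add: norm_mult power_mult_distrib del: of_nat_Suc)
      finally have "norm (digamma_rem (of_nat (Suc n) * x))
          \<le> 16 / norm x ^ 2 * (1 / real (Suc n) ^ 2)" .
      moreover have "norm (1 / of_nat (Suc n) ^ k :: complex) \<le> 1"
        by (simp add: norm_divide norm_power del: of_nat_Suc)
      ultimately have "norm (f n) \<le> 1 * (16 / norm x ^ 2 * (1 / real (Suc n) ^ 2))"
        unfolding f_def norm_mult[of "1 / of_nat (Suc n) ^ k"] by (intro mult_mono) auto
      then show ?case by simp
    qed
    show "summable (\<lambda>n. 16 / norm x ^ 2 * (1 / real (Suc n) ^ 2))"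
      using inverse_squares_sums by (intro summable_mult) (auto simp: sums_iff add_ac)
  qed
  then have "(\<lambda>M. \<Sum>n<M. f n) \<longlonglongrightarrow> suminf f" using summable_sums sums_def by blast
  moreover have "(\<Sum>n<M. f n) = digamma_rem_sum k x M" for M
    unfolding digamma_rem_sum_def f_def
    by (rule sum.reindex_bij_witness[of _ "\<lambda>n. n - 1" Suc]) auto
  moreover have "herglotz_F (real k) 1 x = suminf f"
    unfolding herglotz_F_def f_def digamma_rem_def
    by (intro suminf_cong) (simp add: powr_realpow Let_def del: of_nat_Suc)
  ultimately show ?thesis by simp
qed

text \<open>Reduces the functional equation to elementary sums. Their separate pieces may diverge;
  convergence is required only of the whole combination.\<close>

lemma herglotz_F_reciprocity_limit:
  assumes x: "Re x > 0"
    and lim: "(\<lambda>M. main_part k x M - (- x) ^ k / x * main_part k (1 / x) M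
        - (\<Sum>j<k. (- x) ^ j * power_sum (Suc j) M * power_sum (k - j) M)) \<longlonglongrightarrow> l"
  shows "herglotz_F (real k) 1 x - (- x) ^ k / x * herglotz_F (real k) 1 (1 / x) = l"
proof -
  define c where "c = (- x) ^ k / x"
  have x': "Re (1 / x) > 0" using x by (rule Re_inverse_pos)
  have "(\<lambda>M. digamma_rem_sum k x M - c * digamma_rem_sum k (1 / x) M)
      \<longlonglongrightarrow> herglotz_F (real k) 1 x - c * herglotz_F (real k) 1 (1 / x)"
    by (intro tendsto_intros digamma_rem_sum_tendsto_herglotz_F x x')
  moreover have "(\<lambda>M. digamma_rem_sum k x M - c * digamma_rem_sum k (1 / x) M) \<longlonglongrightarrow> l"
  proof -
    have "(\<lambda>M. (digamma_rem_tail k x M - c * digamma_rem_tail k (1 / x) M)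
        + (main_part k x M - c * main_part k (1 / x) M
        - (\<Sum>j<k. (- x) ^ j * power_sum (Suc j) M * power_sum (k - j) M))) \<longlonglongrightarrow> (0 - c * 0) + l"
      unfolding c_def by (intro tendsto_intros digamma_rem_tail_tendsto_0 lim x x')
    moreover have "\<forall>\<^sub>F M in sequentially. (digamma_rem_tail k x M
        - c * digamma_rem_tail k (1 / x) M) + (main_part k x M - c * main_part k (1 / x) M
        - (\<Sum>j<k. (- x) ^ j * power_sum (Suc j) M * power_sum
            (k - j) M)) = digamma_rem_sum k x M - c * digamma_rem_sum k (1 / x) M"
      using eventually_gt_at_top[of 0]
    proof eventually_elim
      case (elim M)
      show ?case
        using recip_sum_reciprocity[OF x, of k M] recip_sum_eq[OF x elim, of k]
            recip_sum_eq[OF x' elim, of k]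
        unfolding c_def[symmetric] by (simp add: algebra_simps)
    qed
    ultimately have "(\<lambda>M. digamma_rem_sum k x M - c * digamma_rem_sum k (1 / x) M)
        \<longlonglongrightarrow> (0 - c * 0) + l"
      by (rule Lim_transform_eventually)
    then show ?thesis by simp
  qed
  ultimately show ?thesis using LIMSEQ_unique unfolding c_def by blast
qed

section \<open>Passage to the limit\<close>

lemma power_sum_1: "power_sum 1 M = of_real (harm M)"
  by (simp add: power_sum_def harm_def inverse_eq_divide)

lemma power_sum_1_limit: "(\<lambda>M. power_sum 1 M - of_real (ln (real M))) \<longlonglongrightarrow> euler_mascheroni"
  using euler_mascheroni_LIMSEQ_of_real unfolding power_sum_1 by simp

lemma of_nat_powr_minus_of_nat: "n > 0 \<Longrightarrow> of_nat n powr - of_nat j = (1 / of_nat n ^ j :: complex)"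
  by (simp add: powr_minus_divide powr_nat)

lemma power_sum_limit:
  assumes "j \<ge> 2"
  shows "power_sum j \<longlonglongrightarrow> zeta (of_nat j)"
proof -
  have "(\<lambda>M. \<Sum>n=1..M. of_nat n powr - of_nat j) \<longlonglongrightarrow> zeta (of_nat j)"
    using assms by (intro zeta_partial_limit) auto
  moreover have "(\<Sum>n=1..M. of_nat n powr - of_nat j) = power_sum j M" for M
    unfolding power_sum_def by (intro sum.cong) (auto simp: of_nat_powr_minus_of_nat)
  ultimately show ?thesis by simp
qed

lemma log_sum_limit:
  assumes "j \<ge> 2"
  shows "log_sum j \<longlonglongrightarrow> - deriv zeta (of_nat j)"
proof -
  have "(\<lambda>M. \<Sum>n=1..M. of_real (ln (real n)) * of_nat n powr - of_nat j) \<longlonglongrightarrow> - deriv zeta (of_nat j)"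
    using assms by (intro deriv_zeta_partial_limit) auto
  moreover have "(\<Sum>n=1..M. of_real (ln (real n)) * of_nat n powr - of_nat j) = log_sum j M" for M
    unfolding log_sum_def by (intro sum.cong) (auto simp: of_nat_powr_minus_of_nat)
  ultimately show ?thesis by simp
qed

text \<open>Turns the limit of \<open>power_sum 2\<close> into the explicit
  \<open>pi ^ 2 / 12\<close> of the case \<open>k = 1\<close>.\<close>

lemma zeta_2: "zeta 2 = of_real (pi ^ 2 / 6)"
proof -
  have "(\<lambda>M. \<Sum>n<M. 1 / real (Suc n) ^ 2) \<longlonglongrightarrow> pi ^ 2 / 6"
    using inverse_squares_sums unfolding sums_def by (simp add: add_ac)
  then have "(\<lambda>M. of_real (\<Sum>n<M. 1 / real (Suc n) ^ 2)) \<longlonglongrightarrow> complex_of_real (pi ^ 2 / 6)"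
    by (rule tendsto_of_real)
  moreover have "of_real (\<Sum>n<M. 1 / real (Suc n) ^ 2) = power_sum 2 M" for M
    unfolding power_sum_def of_real_sum by (rule sum.reindex_bij_witness[of _ "\<lambda>n. n - 1" Suc]) auto
  ultimately show ?thesis
    using power_sum_limit[of 2] LIMSEQ_unique by (auto simp del: of_real_power of_real_divide)
qed

text \<open>For \<open>k \<ge> 1\<close> the weight is at most \<open>1 / n\<close>. The resulting
  harmonic number grows only logarithmically, so a bound \<open>B\<close> of order
  \<open>1 / M\<close> suffices for the limit 0.\<close>

lemma norm_weighted_sum_le_harm:
  assumes "k \<ge> 1" and f: "\<And>n. n \<in> {1..M} \<Longrightarrow> norm (f n) \<le> B"
  shows "norm (\<Sum>n=1..M. 1 / of_nat n ^ k * f n :: complex) \<le> B * harm M"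
proof -
  have "norm (\<Sum>n=1..M. 1 / of_nat n ^ k * f n :: complex) \<le> (\<Sum>n=1..M. B * inverse (real n))"
  proof (rule sum_norm_le)
    fix n assume n: "n \<in> {1..M}"
    have "real n ^ 1 \<le> real n ^ k" using n assms by (intro power_increasing) auto
    then have "1 / real n ^ k \<le> inverse (real n)" using n by (simp add: field_simps)
    then have "1 / real n ^ k * norm (f n) \<le> inverse (real n) * B"
      using f[OF n] by (intro mult_mono) auto
    then show "norm (1 / of_nat n ^ k * f n) \<le> B * inverse (real n)"
      by (simp add: norm_mult norm_divide norm_power mult_ac)
  qed
  then show ?thesis by (simp add: harm_def sum_distrib_left)
qed

lemma tendsto_0_if_le_harm_over_n:
  assumes "\<And>M. M > 0 \<Longrightarrow> norm (f M :: complex) \<le> C * (harm M / real M)"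
  shows "f \<longlonglongrightarrow> 0"
proof (rule Lim_transform_bound[where g = "\<lambda>M. C * (harm M / real M)"])
  show "(\<lambda>M. C * (harm M / real M)) \<longlonglongrightarrow> 0"
    by (intro tendsto_mult_right_zero harm_over_n_tendsto_0)
  show "\<forall>\<^sub>F M in sequentially. norm (f M) \<le> norm (C * (harm M / real M))"
    using eventually_gt_at_top[of 0]
  proof eventually_elim
    case (elim M)
    show ?case using assms[OF elim] by (rule order_trans) (simp only: real_norm_def abs_ge_self)
  qed
qed

lemma inverse_weighted_tendsto_0:
  assumes x: "Re x > 0" and "k \<ge> 1"
  shows "(\<lambda>M. \<Sum>n=1..M. 1 / of_nat n ^ k * (1 / (of_nat n * x + of_nat M))) \<longlonglongrightarrow> 0"
proof (rule tendsto_0_if_le_harm_over_n[where C = 1])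
  fix M :: nat assume M: "M > 0"
  have "norm (\<Sum>n=1..M. 1 / of_nat n ^ k * (1 / (of_nat n * x + of_nat M))) \<le> 1 / real M * harm M"
  proof (rule norm_weighted_sum_le_harm[OF assms(2)])
    fix n
    have "Re (of_nat n * x + of_nat M) \<ge> real M" using x by simp
    then have "norm (of_nat n * x + of_nat M) \<ge> real M"
      using complex_Re_le_cmod[of "of_nat n * x + of_nat M"] by linarith
    then show "norm (1 / (of_nat n * x + of_nat M)) \<le> 1 / real M"
      using M unfolding norm_divide norm_one by (intro divide_left_mono) (auto intro!: mult_pos_pos)
  qed
  then show "norm (\<Sum>n=1..M. 1 / of_nat n ^ k * (1 / (of_nat n * x + of_nat M)))
      \<le> 1 * (harm M / real M)"
    by simp
qed

text \<open>One factor \<open>1 / n\<close> absorbs the \<open>n\<close> in the bound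
  \<open>n * norm x / M\<close> for the logarithm, and for \<open>k \<ge> 2\<close> at least one
  more is left. The total is at most of order \<open>harm M / M\<close>.\<close>

lemma ratio_sum_tendsto_0:
  assumes x: "Re x > 0" and k: "k \<ge> 2"
  shows "ratio_sum k x \<longlonglongrightarrow> 0"
proof -
  have "(\<lambda>M. \<Sum>n=1..M. 1 / of_nat n ^ k * Ln (1 + of_nat n * x / of_nat M)) \<longlonglongrightarrow> 0"
  proof (rule tendsto_0_if_le_harm_over_n[where C = "norm x"])
    fix M :: nat assume M: "M > 0"
    have "(\<Sum>n=1..M. 1 / of_nat n ^ k * Ln (1 + of_nat n * x / of_nat M))
        = (\<Sum>n=1..M. 1 / of_nat n ^ (k - 1) * (Ln (1 + of_nat n * x / of_nat M) / of_nat n))"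
      using k by (intro sum.cong) (auto simp: power_eq_if[of _ k])
    also have "norm \<dots> \<le> norm x / real M * harm M"
    proof (rule norm_weighted_sum_le_harm)
      fix n assume n: "n \<in> {1..M}"
      have "norm (Ln (1 + of_nat n * x / of_nat M)) \<le> norm (of_nat n * x / of_nat M)"
        using x by (intro norm_Ln_1_plus_le) auto
      then show "norm (Ln (1 + of_nat n * x / of_nat M) / of_nat n) \<le> norm x / real M"
        using n by (simp add: norm_divide norm_mult field_simps)
    qed (use k in auto)
    finally show "norm (\<Sum>n=1..M. 1 / of_nat n ^ k * Ln (1 + of_nat n * x / of_nat M))
        \<le> norm x * (harm M / real M)"
      by simp
  qed
  moreover have "(\<lambda>M. \<Sum>n=1..M. 1 / of_nat n ^ k * (1 / (of_nat n * x + of_nat M))) \<longlonglongrightarrow> 0"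
    using k by (intro inverse_weighted_tendsto_0 x) auto
  ultimately have "(\<lambda>M. (\<Sum>n=1..M. 1 / of_nat n ^ k * Ln (1 + of_nat n * x / of_nat M))
     + 1 / 2 * (\<Sum>n=1..M. 1 / of_nat n ^ k * (1 / (of_nat n * x + of_nat M)))) \<longlonglongrightarrow> 0 + 1 / 2 * 0"
    by (intro tendsto_intros)
  then show ?thesis by (simp add: ratio_sum_def[abs_def])
qed

section \<open>The correction term for \<open>k \<ge> 2\<close>, \<open>k = 1\<close> and
  \<open>k = 0\<close>\<close>

lemma Ln_of_real_mult: "r > 0 \<Longrightarrow> z \<noteq> 0 \<Longrightarrow> Ln (of_real r * z) = of_real (ln r) + Ln z"
  using Ln_times_of_real[of r z] Ln_of_real[of r] by simp

lemma Ln_one_divide: "Re x > 0 \<Longrightarrow> Ln (1 / x) = - Ln x"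
  using Ln_inverse[OF Re_pos_not_nonpos_Reals] by (simp add: inverse_eq_divide)

text \<open>Only the end terms \<open>j = 0\<close> and \<open>j = k - 1\<close> of the reciprocity
  sum contain the divergent \<open>power_sum 1\<close>. They combine with the \<open>ln M\<close> of
  both main parts to \<open>(c - 1) * (power_sum 1 M - ln M) * power_sum k M\<close>, which yields
  Euler's constant. Everything else converges termwise.\<close>

lemma herglotz_B_limit_ge_2:
  assumes x: "Re x > 0" and k: "k \<ge> 2"
  shows "(\<lambda>M. main_part k x M - (- x) ^ k / x * main_part k (1 / x) M
        - (\<Sum>j<k. (- x) ^ j * power_sum (Suc j) M * power_sum (k - j) M))
      \<longlonglongrightarrow> - ((- x) ^ k / x) * herglotz_B k x"
proof -
  define c where "c = (- x) ^ k / x"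
  define z where "z j = zeta (of_nat j)" for j
  have x0: "x \<noteq> 0" using x by auto
  have x': "Re (1 / x) > 0" using x by (rule Re_inverse_pos)
  define mid where "mid f = (\<Sum>j=1..k-2. (- x) ^ j * f (Suc j) * f (k - j))" for f :: "nat \<Rightarrow> complex"
  have split: "(\<Sum>j<k. (- x) ^ j * f (Suc j) * f (k - j)) = f 1 * f k - c * (f k * f 1) + mid f"
      for f :: "nat \<Rightarrow> complex"
  proof -
    obtain i where i: "k = Suc (Suc i)" using k by (metis add_2_eq_Suc le_Suc_ex)
    \<comment> \<open>For \<open>k = 2\<close> the middle range is empty.\<close>
    have ivl: "{..<k} = insert 0 (insert (Suc i) {1..k-2})" using i by auto
    have "(- x) ^ Suc i = - c" using x0 by (simp add: c_def i)
    then show ?thesis unfolding ivl mid_def using i by (subst sum.insert; simp)+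
  qed
  have mid_lim: "(\<lambda>M. mid (\<lambda>j. power_sum j M)) \<longlonglongrightarrow> mid z"
    unfolding mid_def z_def by (intro tendsto_intros power_sum_limit) auto
  have lim: "(\<lambda>M. (c - 1) * ((power_sum 1 M - of_real (ln (real M))) * power_sum k M)
      + (ratio_sum k x M - c * ratio_sum k (1 / x) M)
      + (c - 1) * log_sum k M - (1 + c) * (Ln x * power_sum k M) +
          (c * x / 2 - 1 / (2 * x)) * power_sum (Suc k) M - mid (\<lambda>j. power_sum j M))
    \<longlonglongrightarrow> (c - 1) * (euler_mascheroni * z k) + (0 - c * 0) + (c - 1) * - deriv zeta (of_nat k) -
        (1 + c) * (Ln x * z k)
      + (c * x / 2 - 1 / (2 * x)) * z (Suc k) - mid z"
    unfolding z_def
    using k by (intro tendsto_intros power_sum_1_limit ratio_sum_tendsto_0 x x' log_sum_limit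
        mid_lim[unfolded z_def] power_sum_limit) auto
  have eq: "main_part k x M - c * main_part k (1 / x) M
      - (\<Sum>j<k. (- x) ^ j * power_sum (Suc j) M * power_sum (k - j) M)
     = (c - 1) * ((power_sum 1 M - of_real (ln (real M))) * power_sum k M) +
         (ratio_sum k x M - c * ratio_sum k (1 / x) M)
      + (c - 1) * log_sum k M - (1 + c) * (Ln x * power_sum k M) +
          (c * x / 2 - 1 / (2 * x)) * power_sum (Suc k) M - mid (\<lambda>j. power_sum j M)" for M
    unfolding split[of "\<lambda>j. power_sum j M"] main_part_def Ln_one_divide[OF x]
    using x0 by (simp add: field_simps)
  have "(c - 1) * (euler_mascheroni * z k) + (0 - c * 0)
      + (c - 1) * - deriv zeta (of_nat k) - (1 + c) * (Ln x * z k)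
      + (c * x / 2 - 1 / (2 * x)) * z (Suc k) - mid z = - c * herglotz_B k x"
  proof -
    \<comment> \<open>\<open>e\<close> is the inverse of \<open>c\<close>, so multiplying
      \<open>herglotz_B k x\<close> by \<open>c\<close> strips the power of \<open>x\<close> from
      its second half.\<close>
    define e where "e = (- 1) ^ k * x powi (1 - int k)"
    have ec: "c * e = 1"
    proof -
      have "x powi (1 - int k) = x / x ^ k" using x0 by (simp add: power_int_diff)
      then have "c * e = (- 1) ^ k * (- 1) ^ k * (x ^ k / x * (x / x ^ k))"
        by (simp add: c_def e_def power_minus[of x])
      also have "\<dots> = 1" using x0 by (simp flip: power_mult_distrib)
      finally show ?thesis .
    qed
    have e': "(- 1) ^ k / (2 * x ^ k) = e / (2 * x)"
      using x0 by (simp add: e_def power_int_diff)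
    define s where "s = (\<Sum>j
        = 1..k - 2. (-1) ^ (j - 1) * zeta (of_nat (j + 1)) * zeta (of_nat (k - j)) * x powi
        (- int j))"
    \<comment> \<open>Reversal \<open>j\<close> to \<open>k - 1 - j\<close> exchanges the two zeta
      factors and turns \<open>c\<close> times a negative power of \<open>x\<close> into
      \<open>(- x) ^ j\<close>.\<close>
    have mid: "mid z = c * s"
      unfolding mid_def s_def sum_distrib_left
    proof (rule sum.reindex_bij_witness[of _ "\<lambda>j. k - 1 - j" "\<lambda>j. k - 1 - j"])
      fix j assume j: "j \<in> {1..k - 2}"
      then obtain i where i: "k = i + j + 1" "i \<ge> 1" 
        using k by (auto intro: that[of "k - 1 - j"])
      have ij: "k - 1 - j = i" using i by simp
      have "c * ((- 1) ^ (i - 1) * x powi (- int i)) = (- x) ^ j"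
      proof -
        obtain i' where i': "i = Suc i'" using i by (cases i) auto
        have "c = (- x) ^ j * ((- 1) ^ i' * x ^ i)"
          using x0 by (simp add: c_def i i' power_add power_minus[of x] mult_ac)
        then have "c * ((- 1) ^ (i - 1) * x powi (- int i))
            = (- x) ^ j * ((- 1) ^ i' * (- 1) ^ i') * (x ^ i * x powi (- int i))"
          by (simp add: i' mult_ac)
        also have "(- 1) ^ i' * (- 1) ^ i' = (1 :: complex)" by (simp flip: power_mult_distrib)
        also have "x ^ i * x powi (- int i) = 1" using x0 by (simp add: power_int_minus)
        finally show ?thesis by simp
      qed
      then show "c * ((-1) ^ (k - 1 - j
          - 1) * zeta (of_nat (k - 1 - j + 1)) * zeta (of_nat (k - (k - 1 - j))) * x powi
          (- int (k - 1 - j)))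
          = (- x) ^ j * z (Suc j) * z (k - j)"
        unfolding ij using i by (simp add: z_def mult_ac)
    qed auto
    have B: "herglotz_B k x = z k * (Ln x - euler_mascheroni) + deriv zeta (of_nat k)
       + e * ((Ln x + euler_mascheroni) * z k - deriv zeta (of_nat k)) + e / (2 * x) * z
           (Suc k) - x / 2 * z (Suc k) + s"
      using k unfolding herglotz_B_def e'[symmetric] by (simp add: e_def s_def z_def)
    have "c * herglotz_B k x = c * (z k * (Ln x - euler_mascheroni) + deriv zeta (of_nat k))
       + (c * e) * ((Ln x + euler_mascheroni) * z k - deriv zeta (of_nat k)) + (c * e) / (2 * x) * z
           (Suc k) - c * x / 2 * z (Suc k) + c * s"
      unfolding B by (simp add: algebra_simps)
    then show ?thesis unfolding ec mid by (simp add: algebra_simps)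
  qed
  with lim show ?thesis unfolding c_def[symmetric] eq by simp
qed

text \<open>Here \<open>c = - 1\<close>, and the divergent terms
  \<open>2 * l * H - H ^ 2 - 2 * S\<close>, with \<open>l = ln M\<close>,
  \<open>H = power_sum 1 M\<close> and \<open>S = log_sum 1 M\<close>, are handled by completing the
  square: they equal \<open>- (H - l) ^ 2 - 2 * (S - l ^ 2 / 2)\<close>. This produces the squared
  Euler constant and the Stieltjes constant.\<close>

lemma herglotz_B_limit_1:
  assumes x: "Re x > 0"
  shows "(\<lambda>M. main_part 1 x M - (- x) ^ 1 / x * main_part 1 (1 / x) M
        - (\<Sum>j<1. (- x) ^ j * power_sum (Suc j) M * power_sum (1 - j) M))
      \<longlonglongrightarrow> - ((- x) ^ 1 / x) * herglotz_B 1 x"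
proof -
  have x0: "x \<noteq> 0" using x by auto
  have x': "Re (1 / x) > 0" using x by (rule Re_inverse_pos)
  define R where "R M = (\<Sum>n=1..M. Ln (1 + of_nat n * x / of_nat M) / of_nat n)
            + (\<Sum>n=1..M. Ln (1 + of_nat n * (1 / x) / of_nat M) / of_nat n)" for M
  define V where "V y M = (\<Sum>n=1..M. 1 / of_nat n ^ 1 * (1 / (of_nat n * y + of_nat M)))"
      for y :: complex and M
  define g where "g M = power_sum 1 M - of_real (ln (real M))" for M
  define t where "t M = log_sum 1 M - of_real (ln (real M) ^ 2 / 2)" for M
  have R: "R \<longlonglongrightarrow> of_real (pi ^ 2 / 6) + (Ln x)\<^sup>2 / 2"
    unfolding R_def by (rule sum_Ln_over_n_limit[OF x])
  have V: "V y \<longlonglongrightarrow> 0" if "Re y > 0" for y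
    unfolding V_def by (intro inverse_weighted_tendsto_0 that) auto
  have g: "g \<longlonglongrightarrow> euler_mascheroni" unfolding g_def by (rule power_sum_1_limit)
  have "log_sum 1 M = (\<Sum>n=1..M. of_real (ln (real n) / real n))" for M
    by (simp add: log_sum_def)
  then have t: "t \<longlonglongrightarrow> stieltjes_1"
    unfolding t_def using stieltjes_1_limit by (simp only:)
  have "(\<lambda>M. R M + 1 / 2 * (V x M + V (1 / x) M) - g M ^ 2 - 2 * t M
      - (x + 1 / x) / 2 * power_sum 2 M)
     \<longlonglongrightarrow> (of_real (pi ^ 2 / 6) + (Ln x)\<^sup>2 / 2) + 1 / 2 *
         (0 + 0) - euler_mascheroni ^ 2 - 2 * stieltjes_1 - (x + 1 / x) / 2 * zeta (of_nat 2)"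
    by (intro tendsto_intros R V g t x x' power_sum_limit) auto
  moreover have "main_part 1 x M - (- x) ^ 1 / x * main_part 1 (1 / x) M
        - (\<Sum>j<1. (- x) ^ j * power_sum (Suc j) M * power_sum (1 - j) M)
      = R M + 1 / 2 * (V x M + V (1 / x) M) - g M ^ 2 - 2 * t M -
          (x + 1 / x) / 2 * power_sum 2 M" for M
  proof -
    have "ratio_sum 1 x M + ratio_sum 1 (1 / x) M = R M + 1 / 2 * (V x M + V (1 / x) M)"
      unfolding ratio_sum_def R_def V_def by (simp add: algebra_simps)
    moreover have "main_part 1 x M + main_part 1 (1 / x) M
        = 2 * (of_real (ln (real M)) * power_sum 1 M)
       + (ratio_sum 1 x M + ratio_sum 1 (1 / x) M) - 2 * log_sum 1 M -
           (x + 1 / x) / 2 * power_sum 2 M"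
      unfolding main_part_def Ln_one_divide[OF x] using x0 by (simp add: field_simps numeral_2_eq_2)
    moreover have "(- x) ^ 1 / x = - 1" using x0 by simp
    ultimately show ?thesis by (simp add: g_def t_def power2_eq_square algebra_simps)
  qed
  moreover have "(of_real (pi ^ 2 / 6) + (Ln x)\<^sup>2 / 2)
      + 1 / 2 * (0 + 0) - euler_mascheroni ^ 2 - 2 * stieltjes_1 - (x + 1 / x) / 2 * zeta (of_nat 2)
     = - ((- x) ^ 1 / x) * herglotz_B 1 x"
  proof -
    have "(- x) ^ 1 / x = - 1" using x0 by simp
    then show ?thesis by (simp add: herglotz_B_def zeta_2 algebra_simps)
  qed
  ultimately show ?thesis by simp
qed

text \<open>Replacing each sum by its deviation \<open>q\<close>, \<open>t\<close> or
  \<open>g\<close> from its growth cancels every term of order \<open>M\<close>,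
  \<open>M * ln M\<close> and \<open>ln M\<close> between \<open>x\<close> and \<open>1 / x\<close>.
  The cancellation of the linear terms rests on
  \<open>Ln (1 + 1 / x) = Ln (1 + x) - Ln x\<close>.\<close>

lemma herglotz_B_limit_0:
  assumes x: "Re x > 0"
  shows "(\<lambda>M. main_part 0 x M - (- x) ^ 0 / x * main_part 0 (1 / x) M
        - (\<Sum>j<0. (- x) ^ j * power_sum (Suc j) M * power_sum (0 - j) M))
      \<longlonglongrightarrow> - ((- x) ^ 0 / x) * herglotz_B 0 x"
proof -
  have x0: "x \<noteq> 0" using x by auto
  have x': "Re (1 / x) > 0" using x by (rule Re_inverse_pos)
  define q where "q y M = ratio_sum 0 y M - of_nat M * ((1 + 1 / y) * Ln (1 + y) - 1)"
      for y :: complex and M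
  define g where "g M = power_sum 1 M - of_real (ln (real M))" for M
  define t where "t M = log_sum 0 M - of_real ((real M + 1 / 2) * ln (real M) - real M)" for M
  have q: "q y \<longlonglongrightarrow> Ln (1 + y) / 2 + 1 / 2 * (Ln (1 + y) / y)" if y: "Re y > 0" for y
  proof -
    have "(\<lambda>M. (\<Sum>n=1..M. Ln (1 + of_nat n * y / of_nat M))
        - of_nat M * ((1 + 1 / y) * Ln (1 + y) - 1)
       + 1 / 2 * (\<Sum>n=1..M. 1 / (of_nat n * y + of_nat M))) \<longlonglongrightarrow> Ln (1 + y) / 2 + 1 / 2 *
           (Ln (1 + y) / y)"
      by (intro tendsto_add tendsto_mult tendsto_const sum_Ln_limit sum_inverse_limit y)
    then show ?thesis by (simp add: q_def[abs_def] ratio_sum_def algebra_simps)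
  qed
  have g: "g \<longlonglongrightarrow> euler_mascheroni" unfolding g_def by (rule power_sum_1_limit)
  have "log_sum 0 M = of_real (ln (fact M))" for M
    by (induction M) (simp_all add: log_sum_def ln_mult del: of_nat_Suc)
  then have t: "t \<longlonglongrightarrow> of_real (ln (2 * pi) / 2)"
    using tendsto_of_real[OF stirling_ln_fact, where 'a = complex] unfolding t_def
        by (simp only: of_real_diff)
  have "(\<lambda>M. (1 / x - 1) * t M + (q x M - 1 / x * q (1 / x) M) + (1 - 1 / x) / 2 * g M) \<longlonglongrightarrow>
     (1 / x - 1) * of_real (ln (2 * pi) / 2) + ((Ln (1 + x) / 2 + 1 / 2 * (Ln (1 + x) / x))
      - 1 / x * (Ln (1 + 1 / x) / 2 + 1 / 2 * (Ln (1 + 1 / x) / (1 / x)))) +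
          (1 - 1 / x) / 2 * euler_mascheroni"
    by (intro tendsto_intros t q g x x')
  moreover have "main_part 0 x M - (- x) ^ 0 / x * main_part 0 (1 / x) M
        - (\<Sum>j<0. (- x) ^ j * power_sum (Suc j) M * power_sum (0 - j) M)
      = (1 / x - 1) * t M + (q x M - 1 / x * q (1 / x) M) + (1 - 1 / x) / 2 * g M" for M
  proof -
    define l where "l = complex_of_real (ln (real M))"
    have t': "log_sum 0 M = t M + (of_nat M + 1 / 2) * l - of_nat M" by (simp add: t_def l_def)
    have g': "power_sum (Suc 0) M = g M + l" by (simp add: g_def l_def)
    have p0: "power_sum 0 M = of_nat M" by (simp add: power_sum_def)
    have q1: "ratio_sum 0 x M = q x M + of_nat M * ((1 + 1 / x) * Ln (1 + x) - 1)"
      by (simp add: q_def)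
    have q2: "ratio_sum 0 (1 / x) M = q (1 / x) M + of_nat M * ((1 + x) * (Ln (1 + x) - Ln x) - 1)"
      by (simp add: q_def Ln_1_plus_inverse[OF x, symmetric])
    show ?thesis
      unfolding main_part_def Ln_one_divide[OF x] t' g' p0 q1 q2 l_def[symmetric]
      using x0 by (simp add: field_simps)
  qed
  moreover have "(1 / x - 1) * of_real (ln (2 * pi) / 2)
      + ((Ln (1 + x) / 2 + 1 / 2 * (Ln (1 + x) / x))
      - 1 / x * (Ln (1 + 1 / x) / 2 + 1 / 2 * (Ln (1 + 1 / x) / (1 / x)))) +
          (1 - 1 / x) / 2 * euler_mascheroni
    = - ((- x) ^ 0 / x) * herglotz_B 0 x"
  proof -
    have L1: "Ln (2 * of_real pi * x) = of_real (ln (2 * pi)) + Ln x"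
      using Ln_of_real_mult[of "2 * pi" x] x0 by simp
    have "Ln (of_real (2 * pi) * (1 / x)) = of_real (ln (2 * pi)) + Ln (1 / x)"
      using x0 by (intro Ln_of_real_mult) auto
    then have L2: "Ln (2 * of_real pi / x) = of_real (ln (2 * pi)) - Ln x"
      by (simp add: Ln_one_divide[OF x])
    have B: "herglotz_B 0 x
        = x / 2 * (of_real (ln (2 * pi)) - Ln x - euler_mascheroni) + 1 / 2 *
        (euler_mascheroni - (of_real (ln (2 * pi)) + Ln x))"
      by (simp add: herglotz_B_def L1 L2)
    define p where "p = complex_of_real (ln (2 * pi))"
    have p: "of_real (ln (2 * pi) / 2) = p / 2" by (simp add: p_def)
    show ?thesis unfolding B Ln_1_plus_inverse[OF x] p unfolding p_def[symmetric]
    proof -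
      define a where "a = 1 / x"
      define L l g where "L = Ln (1 + x)" and "l = Ln x" and "g = (euler_mascheroni :: complex)"
      have ax: "a * x = 1" using x0 by (simp add: a_def)
      have "a * ((L - l) / 2 + 1 / 2 * ((L - l) * x)) = a * (L - l) / 2 + (a * x) * (L - l) / 2"
        by (simp add: field_simps)
      moreover have "a * (x / 2 * (p - l - g) + 1 / 2 * (g - (p + l)))
          = (a * x) * (p - l - g) / 2 + a * (g - (p + l)) / 2"
        by (simp add: field_simps)
      moreover have "L / x = L * a" "(L - l) / a = (L - l) * x" "(- x) ^ 0 / x = a"
          by (simp_all add: a_def)
      ultimately show "(1 / x - 1) * (p / 2) + ((Ln (1 + x) / 2 + 1 / 2 * (Ln (1 + x) / x))
          - 1 / x * ((Ln (1 + x) - Ln x) / 2 + 1 / 2 * ((Ln (1 + x) - Ln x) / (1 / x)))) +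
              (1 - 1 / x) / 2 * euler_mascheroni
        = - ((- x) ^ 0 / x) *
            (x / 2 * (p - Ln x - euler_mascheroni) + 1 / 2 * (euler_mascheroni - (p + Ln x)))"
        unfolding a_def[symmetric] L_def[symmetric] l_def[symmetric] g_def[symmetric] ax
        by (simp only: mult_minus_left) (simp add: field_simps)
    qed
  qed
  ultimately show ?thesis by simp
qed

theorem theorem2p1:
  fixes k :: nat and x :: complex
  assumes "Re x > 0"
  shows "herglotz_F (real k) 1 x =
    (-1) ^ k * x powi (int k - 1) * (herglotz_F (real k) 1 (1 / x) - herglotz_B k x)"
proof -
  have x0: "x \<noteq> 0" using assms by auto
  have c: "(-1) ^ k * x powi (int k - 1) = (- x) ^ k / x"
    using x0 by (simp add: power_int_diff power_minus[of x])
  have "herglotz_F (real k) 1 x - (- x) ^ k / x * herglotz_F (real k) 1 (1 / x)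
      = - ((- x) ^ k / x) * herglotz_B k x"
  proof (rule herglotz_F_reciprocity_limit[OF assms])
    consider "k = 0" | "k = 1" | "k \<ge> 2" by linarith
    then show "(\<lambda>M. main_part k x M - (- x) ^ k / x * main_part k (1 / x) M
        - (\<Sum>j<k. (- x) ^ j * power_sum (Suc j) M * power_sum (k - j) M))
      \<longlonglongrightarrow> - ((- x) ^ k / x) * herglotz_B k x"
      using herglotz_B_limit_0[OF assms] herglotz_B_limit_1[OF assms]
          herglotz_B_limit_ge_2[OF assms]
      by cases (simp_all only:)
  qed
  then show ?thesis unfolding c by (simp add: algebra_simps)
qed

end
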